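(* Let $p,q$ be relatively prime positive integers with $q>p$. Then $\mathcal{C}_{p,q}=\widetilde{\mathcal{C}}_{p,q-p}$, i.e. the curve $\mathcal{C}_{p,q}$ is the proper transform under the Heron transformation $H$ of $\mathcal{C}_{p,q-p}$ (equivalently, $f_{p,q}=\widetilde{f}_{p,q-p}$ up to a nonzero constant factor). All singular points of $\mathcal{C}_{p,q}$, if any, are among the gate points $E_\pm,F_\pm,G_\pm$ and the source point $G_0$. The algebraic multiplicity of $G_0$ on $\mathcal{C}_{p,q}$ is $\min(p,q)$, and the algebraic multiplicities of the gate points on $\mathcal{C}_{p,q}$ are as follows, depending on the parities of $p$ and $q$. \begin{itemize} \item $p$ odd, $q$ odd: $E_+:\frac{p-1}{2}$, $E_-:\frac{p-1}{2}$, $F_+:\frac{q-1}{2}$, $F_-:\frac{q-1}{2}$, $G_+:\frac{p+q}{2}$, $G_-:\frac{p+q}{2}-1$. \item $p$ odd, $q$ even: $E_+:\frac{p-1}{2}$, $E_-:\frac{p-1}{2}$, $F_+:\frac{q}{2}-1$, $F_-:\frac{q}{2}$, $G_+:\frac{p+q-1}{2}$, $G_-:\frac{p+q-1}{2}$. \item $p$ even, $q$ odd: $E_+:\frac{p}{2}-1$, $E_-:\frac{p}{2}$, $F_+:\frac{q-1}{2}$, $F_-:\frac{q-1}{2}$, $G_+:\frac{p+q-1}{2}$, $G_-:\frac{p+q-1}{2}$. \end{itemize} (These numbers are equal to the self-intersection multiplicities of the gate points, i.e. the numbers of distinct parameter values $t$ that the parametrization $\Gamma_{p,q}$ maps to them.)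 Moreover, up to a nonzero constant factor, $$f_{p,q-p}\circ H=(b+a)^{m_{p,q}^+}\,(b-a)^{m_{p,q}^-}\,f_{p,q},$$ where $m_{p,q}^+=m_{p,q}^-=\frac{q-p-1}{2}$ if $q-p$ is odd, while $m_{p,q}^+=\frac{q-p}{2}$ and $m_{p,q}^-=\frac{q-p}{2}-1$ if $q-p$ is even.
   Context: Homogeneous coordinates on $\mathbb{C}P^2$ are $[a:b:c]$. $U_n$ denotes the $n$-th Chebyshev polynomial of the second kind: $U_0=1$, $U_1=2t$, $U_{n+1}=2tU_n-U_{n-1}$, so $U_n(\cos\theta)=\frac{\sin((n+1)\theta)}{\sin\theta}$. For relatively prime positive integers $p,q$, let $\Gamma_{p,q}(t)=[U_{p-1}(t):U_{q-1}(t):U_{p+q-1}(t)]$, $t\in\mathbb{C}$, and let $f_{p,q}\in\mathbb{C}[a,b,c]$ be the nonzero homogeneous polynomial of minimal degree with $f_{p,q}(U_{p-1}(t),U_{q-1}(t),U_{p+q-1}(t))=0$ as a polynomial in $t$ (it is unique up to scale, irreducible, and of degree $p+q-1$). A plane algebraic curve $\mathcal{C}_f$ is identified with its defining nonzero homogeneous polynomial $f$ up to a nonzero constant (so multiplicities count); $\mathcal{C}_{p,q}:=\mathcal{C}_{f_{p,q}}$ (the $p:q$ Chebyshev curve). Gate points: $E_\pm=[0:1:\pm1]$, $F_\pm=[1:0:\pm1]$, $G_\pm=[1:\pm1:0]$. Source point: $G_0=[0:0:1]$. Heron transformation: the rational map $H:\mathbb{C}P^2\dashrightarrow\mathbb{C}P^2$,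 $H([a:b:c])=[ac:b^2-a^2:bc]$; for a homogeneous polynomial $f$, $f\circ H$ denotes the homogeneous polynomial $f(ac,\,b^2-a^2,\,bc)$. The exceptional lines of $H$ (lines mapped to points) are $c=0$, $b-a=0$, $b+a=0$, and $c$, $b-a$, $b+a$ are the exceptional factors. $\widetilde{f}$ denotes the polynomial obtained from $f\circ H$ by dividing out all exceptional factors (to their full powers), and $\widetilde{\mathcal{C}}_f:=\mathcal{C}_{\widetilde f}$ is the proper transform of $\mathcal{C}_f$. We write $\widetilde{\mathcal{C}}_{p,q}$ and $\widetilde{f}_{p,q}$ for $f=f_{p,q}$. Algebraic multiplicity $m_f(\xi)$ of a point $\xi\in\mathbb{C}P^2$ on $\mathcal{C}_f$: the lowest degree of a nonzero homogeneous term in the Taylor expansion at $\xi$ of $f$ written in affine coordinates around $\xi$; it is $0$ if $\xi\notin\mathcal{C}_f$. The point $\xi$ is singular if $m_f(\xi)\ge 2$. *)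

theory Defs
  imports "HOL-Computational_Algebra.Computational_Algebra" "HOL-Computational_Algebra.Field_as_Ring"
begin

text \<open>
  \<open>\<complex>[a,b,c]\<close> is rendered as \<open>\<complex>[a][b][c]\<close>: the outermost variable is \<open>c\<close>, and
  \<open>coeff (coeff (coeff f k) j) i\<close> is the coefficient of \<open>a\<^sup>i b\<^sup>j c\<^sup>k\<close>.
\<close>

type_synonym poly3 = "complex poly poly poly"

definition const3 :: "complex \<Rightarrow> poly3" where
  "const3 k = [:[:[:k:]:]:]"

definition var_a :: poly3 where "var_a = [:[:[:0, 1:]:]:]"
definition var_b :: poly3 where "var_b = [:[:0, 1:]:]"
definition var_c :: poly3 where "var_c = [:0, 1:]"

definition homogeneous3 :: "nat \<Rightarrow> poly3 \<Rightarrow> bool" where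
  "homogeneous3 d f \<longleftrightarrow> (\<forall>i j k. coeff (coeff (coeff f k) j) i \<noteq> 0 \<longrightarrow> i + j + k = d)"

text \<open>
  The value \<open>f(x,y,z)\<close> in a commutative \<open>\<complex>\<close>-algebra whose structure map is \<open>\<iota>\<close>.
\<close>

definition subst3 :: "(complex \<Rightarrow> 'r::comm_ring_1) \<Rightarrow> poly3 \<Rightarrow> 'r \<Rightarrow> 'r \<Rightarrow> 'r \<Rightarrow> 'r" where
  "subst3 \<iota> f x y z =
     poly (map_poly (\<lambda>g. poly (map_poly (\<lambda>h. poly (map_poly \<iota> h) x) g) y) f) z"

text \<open>
  A plane algebraic curve is its defining polynomial up to a nonzero constant factor,
  so multiplicities of components are retained.
\<close>

definition plane_curve :: "poly3 \<Rightarrow> poly3 set" where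
  "plane_curve f = {const3 k * f | k. k \<noteq> 0}"

definition proportional :: "complex \<times> complex \<times> complex \<Rightarrow> complex \<times> complex \<times> complex \<Rightarrow> bool" where
  "proportional = (\<lambda>(x, y, z) (x', y', z').
     (x, y, z) \<noteq> (0, 0, 0) \<and> (\<exists>k. k \<noteq> 0 \<and> x' = k * x \<and> y' = k * y \<and> z' = k * z))"

lemma part_equivp_proportional: "part_equivp proportional"
proof (rule part_equivpI)
  show "\<exists>v. proportional v v"
    by (rule exI[of _ "(1, 0, 0)"]) (auto simp: proportional_def intro: exI[of _ 1])
  show "symp proportional"
  proof (rule sympI)
    fix v w assume "proportional v w"
    moreover obtain x y z where v: "v = (x, y, z)" by (cases v)
    moreover obtain x' y' z' where w: "w = (x', y', z')" by (cases w)
    ultimately obtain k where nz: "(x, y, z) \<noteq> (0, 0, 0)" and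
      k: "k \<noteq> 0" "x' = k * x" "y' = k * y" "z' = k * z"
      by (auto simp: proportional_def)
    have "inverse k \<noteq> 0 \<and> x = inverse k * x' \<and> y = inverse k * y' \<and> z = inverse k * z'"
      using k by simp
    moreover have "(x', y', z') \<noteq> (0, 0, 0)" using nz k by auto
    ultimately show "proportional w v"
      unfolding v w proportional_def by blast
  qed
  show "transp proportional"
  proof (rule transpI)
    fix u v w assume "proportional u v" "proportional v w"
    moreover obtain x y z where u: "u = (x, y, z)" by (cases u)
    moreover obtain x' y' z' where v: "v = (x', y', z')" by (cases v)
    moreover obtain x'' y'' z'' where w: "w = (x'', y'', z'')" by (cases w)
    ultimately obtain k l where nz: "(x, y, z) \<noteq> (0, 0, 0)" and
      "k \<noteq> 0" "x' = k * x" "y' = k * y" "z' = k * z"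
      "l \<noteq> 0" "x'' = l * x'" "y'' = l * y'" "z'' = l * z'"
      by (auto simp: proportional_def)
    hence "l * k \<noteq> 0 \<and> x'' = (l * k) * x \<and> y'' = (l * k) * y \<and> z'' = (l * k) * z"
      by simp
    with nz show "proportional u w"
      unfolding u w proportional_def by blast
  qed
qed

quotient_type cp2 = "complex \<times> complex \<times> complex" / partial: proportional
  by (rule part_equivp_proportional)

text \<open>The point \<open>[x:y:z]\<close>; unspecified for \<open>x = y = z = 0\<close>.\<close>

definition hpoint :: "complex \<Rightarrow> complex \<Rightarrow> complex \<Rightarrow> cp2" where
  "hpoint x y z = abs_cp2 (x, y, z)"

lemma hpoint_eq_iff:
  assumes "(x, y, z) \<noteq> (0, 0, 0)" and "(x', y', z') \<noteq> (0, 0, 0)"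
  shows "hpoint x y z = hpoint x' y' z' \<longleftrightarrow>
    (\<exists>k. k \<noteq> 0 \<and> x' = k * x \<and> y' = k * y \<and> z' = k * z)"
proof -
  have refl: "proportional (u, v, w) (u, v, w)" if "(u, v, w) \<noteq> (0, 0, 0)" for u v w
    using that by (auto simp: proportional_def intro: exI[of _ 1])
  show ?thesis
    using Quotient3_rel[OF Quotient3_cp2, of "(x, y, z)" "(x', y', z')"]
      refl[OF assms(1)] refl[OF assms(2)] assms(1)
    by (auto simp: hpoint_def proportional_def)
qed

definition const2 :: "complex \<Rightarrow> complex poly poly" where
  "const2 k = [:[:k:]:]"

definition var_X :: "complex poly poly" where "var_X = [:[:0, 1:]:]"
definition var_Y :: "complex poly poly" where "var_Y = [:0, 1:]"

text \<open>
  The dehomogenisation of \<open>f\<close> in a standard affine chart containing \<open>[x:y:z]\<close>, translated so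
  that the point becomes the origin. Its coefficients are the Taylor coefficients at the point.
\<close>

definition local_expansion :: "poly3 \<Rightarrow> complex \<times> complex \<times> complex \<Rightarrow> complex poly poly" where
  "local_expansion f = (\<lambda>(x, y, z).
     if z \<noteq> 0 then subst3 const2 f (const2 (x / z) + var_X) (const2 (y / z) + var_Y) 1
     else if y \<noteq> 0 then subst3 const2 f (const2 (x / y) + var_X) 1 (const2 (z / y) + var_Y)
     else subst3 const2 f 1 (const2 (y / x) + var_X) (const2 (z / x) + var_Y))"

definition lowest_degree :: "complex poly poly \<Rightarrow> nat" where
  "lowest_degree g = (LEAST d. \<exists>i j. i + j = d \<and> coeff (coeff g j) i \<noteq> 0)"

lift_definition alg_mult :: "poly3 \<Rightarrow> cp2 \<Rightarrow> nat"
  is "\<lambda>f \<xi>. lowest_degree (local_expansion f \<xi>)"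
  by (auto simp: proportional_def local_expansion_def)

definition singular_point :: "poly3 \<Rightarrow> cp2 \<Rightarrow> bool" where
  "singular_point f \<xi> \<longleftrightarrow> alg_mult f \<xi> \<ge> 2"

fun cheb_U :: "nat \<Rightarrow> complex poly" where
  "cheb_U 0 = 1"
| "cheb_U (Suc 0) = [:0, 2:]"
| "cheb_U (Suc (Suc n)) = [:0, 2:] * cheb_U (Suc n) - cheb_U n"

definition cheb_param :: "nat \<Rightarrow> nat \<Rightarrow> complex \<Rightarrow> cp2" where
  "cheb_param p q t =
     hpoint (poly (cheb_U (p - 1)) t) (poly (cheb_U (q - 1)) t) (poly (cheb_U (p + q - 1)) t)"

definition vanishes_on_param :: "nat \<Rightarrow> nat \<Rightarrow> poly3 \<Rightarrow> bool" where
  "vanishes_on_param p q f \<longleftrightarrow>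
     subst3 (\<lambda>k. [:k:]) f (cheb_U (p - 1)) (cheb_U (q - 1)) (cheb_U (p + q - 1)) = 0"

definition is_cheb_form :: "nat \<Rightarrow> nat \<Rightarrow> poly3 \<Rightarrow> bool" where
  "is_cheb_form p q f \<longleftrightarrow>
     (\<exists>d. f \<noteq> 0 \<and> homogeneous3 d f \<and> vanishes_on_param p q f \<and>
       (\<forall>g e. g \<noteq> 0 \<and> homogeneous3 e g \<and> vanishes_on_param p q g \<longrightarrow> d \<le> e))"

text \<open>The polynomial is determined only up to a nonzero constant; we fix a representative.\<close>

definition cheb_form :: "nat \<Rightarrow> nat \<Rightarrow> poly3" where
  "cheb_form p q = (SOME f. is_cheb_form p q f)"

definition cheb_curve :: "nat \<Rightarrow> nat \<Rightarrow> poly3 set" where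
  "cheb_curve p q = plane_curve (cheb_form p q)"

definition E_plus :: cp2 where "E_plus = hpoint 0 1 1"
definition E_minus :: cp2 where "E_minus = hpoint 0 1 (-1)"
definition F_plus :: cp2 where "F_plus = hpoint 1 0 1"
definition F_minus :: cp2 where "F_minus = hpoint 1 0 (-1)"
definition G_plus :: cp2 where "G_plus = hpoint 1 1 0"
definition G_minus :: cp2 where "G_minus = hpoint 1 (-1) 0"
definition G_zero :: cp2 where "G_zero = hpoint 0 0 1"

definition gate_points :: "cp2 set" where
  "gate_points = {E_plus, E_minus, F_plus, F_minus, G_plus, G_minus}"

text \<open>The pullback \<open>f \<circ> H\<close> along \<open>H([a:b:c]) = [ac : b\<^sup>2 - a\<^sup>2 : bc]\<close>.\<close>

definition heron_pullback :: "poly3 \<Rightarrow> poly3" where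
  "heron_pullback f =
     subst3 const3 f (var_a * var_c) (var_b ^ 2 - var_a ^ 2) (var_b * var_c)"

definition proper_transform :: "poly3 \<Rightarrow> poly3" where
  "proper_transform f =
     (let g = heron_pullback f in
      g div (var_c ^ multiplicity var_c g *
             (var_b - var_a) ^ multiplicity (var_b - var_a) g *
             (var_b + var_a) ^ multiplicity (var_b + var_a) g))"

end

theory Submission
  imports Defs
begin

text \<open>
  Existence of \<open>f\<^bsub>p,q\<^esub>\<close> in degree \<open>p + q - 1\<close> follows by Euclidean descent: \<open>H\<close> maps
  \<open>\<Gamma>\<^bsub>p,q\<^esub>\<close> to \<open>\<Gamma>\<^bsub>p,q-p\<^esub>\<close> because \<open>sin\<^sup>2 y - sin\<^sup>2 x = sin (y + x) sin (y - x)\<close>. It contracts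
  \<open>b = \<plusminus>a\<close> to the gate points \<open>F\<^sub>\<plusminus>\<close>, so the pullback of a form vanishing to order \<open>m\<close> there is
  divisible by \<open>(b \<mp> a)\<^sup>m\<close>. The descent carries along lower bounds for the orders of vanishing at all
  gate points.

  Everything else comes from intersecting with a generic line through a point \<open>\<xi>\<close>. The
  parametrization is an immersion and injective off the coordinate lines, so such a line meets the
  curve in at least \<open>p + q - 1 - |\<Gamma>\<inverse>(\<xi>)|\<close> distinct points other than \<open>\<xi>\<close>. Hence a form of degree
  \<open>e\<close> vanishing on the curve satisfies \<open>m(\<xi>) + p + q - 1 \<le> e + |\<Gamma>\<inverse>(\<xi>)|\<close> for \<open>\<xi> \<noteq> G\<^sub>0\<close>. With
  \<open>\<xi> = [1:0:0]\<close>, which is not on the curve, this gives minimality of the degree and uniqueness of the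
  form; at other points it bounds the multiplicities from above by the number of parameters.
\<close>

subsection \<open>Ring homomorphisms and substitution\<close>

text \<open>The exponents of the descent are forced by degrees. With q = p + r the pullback has
  degree 2(p + r - 1) and the target has degree p + q - 1, so exactly r - 1 linear factors must
  split off. The orders (r - 1) div 2 at F_+ and r div 2 at F_- supply precisely these. The bounds
  have to be carried together because the gates feed one another: H fixes E_\<plusminus>, sends F_+
  to G_- and F_- to G_+, and is undefined at G_\<plusminus>, where the order is the degree of the
  old form minus what the split factors absorb. The descent gives only lower bounds, and by itself
  it does not show that the form obtained is minimal; counting parameters closes both gaps. The two
  sides agree because the n - 1 roots of \<open>cheb_S n\<close> fall into (n - 1) div 2 with
  \<open>cheb_T n\<close> = 1 and n div 2 with \<open>cheb_T n\<close> = -1, and this value picks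
  the gate. At G_0, for q > p, a generic line sees only q - 1 finite parameters, which still leaves
  m \<le> p.\<close>

definition is_hom :: "('r::comm_ring_1 \<Rightarrow> 's::comm_ring_1) \<Rightarrow> bool" where
  "is_hom \<phi> \<longleftrightarrow> \<phi> 1 = 1 \<and> (\<forall>x y. \<phi> (x + y) = \<phi> x + \<phi> y) \<and> (\<forall>x y. \<phi> (x * y) = \<phi> x * \<phi> y)"

lemma is_homI:
  assumes "\<phi> 1 = 1" "\<And>x y. \<phi> (x + y) = \<phi> x + \<phi> y" "\<And>x y. \<phi> (x * y) = \<phi> x * \<phi> y"
  shows "is_hom \<phi>"
  using assms by (simp add: is_hom_def)

lemma
  assumes "is_hom \<phi>"
  shows is_hom_one: "\<phi> 1 = 1"
    and is_hom_add: "\<phi> (x + y) = \<phi> x + \<phi> y"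
    and is_hom_mult: "\<phi> (x * y) = \<phi> x * \<phi> y"
    and is_hom_zero: "\<phi> 0 = 0"
    and is_hom_diff: "\<phi> (x - y) = \<phi> x - \<phi> y"
    and is_hom_power: "\<phi> (x ^ n) = \<phi> x ^ n"
proof -
  show 1: "\<phi> 1 = 1" and add: "\<And>x y. \<phi> (x + y) = \<phi> x + \<phi> y"
    and mult: "\<And>x y. \<phi> (x * y) = \<phi> x * \<phi> y"
    using assms by (auto simp: is_hom_def)
  show "\<phi> 0 = 0"
    using add[of 0 0] by simp
  show "\<phi> (x - y) = \<phi> x - \<phi> y"
    using add[of "x - y" y] by (simp add: algebra_simps)
  show "\<phi> (x ^ n) = \<phi> x ^ n"
    by (induction n) (simp_all add: 1 mult)
qed

lemmas is_hom_simps =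
  is_hom_zero is_hom_one is_hom_add is_hom_mult is_hom_diff is_hom_power

lemma is_hom_id [simp]: "is_hom (\<lambda>x. x)"
  and is_hom_pconst [simp]: "is_hom (\<lambda>x. [:x:])"
  and is_hom_poly [simp]: "is_hom (\<lambda>p. poly p x)"
  and is_hom_const2 [simp]: "is_hom const2"
  and is_hom_const3 [simp]: "is_hom const3"
  and is_hom_pconst_const3 [simp]: "is_hom (\<lambda>x. [:const3 x:])"
  by (auto intro!: is_homI simp: const2_def const3_def one_pCons)

lemma eval_map_poly_pCons:
  assumes "is_hom \<phi>"
  shows "poly (map_poly \<phi> (pCons c p)) x = \<phi> c + x * poly (map_poly \<phi> p) x"
  using assms by (simp add: map_poly_pCons is_hom_zero)

lemma is_hom_eval:
  assumes "is_hom \<phi>"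
  shows "is_hom (\<lambda>p. poly (map_poly \<phi> p) x)"
proof (rule is_homI)
  note simps = is_hom_simps[OF assms]
  show "poly (map_poly \<phi> 1) x = 1"
    by (simp add: simps)
  show add: "poly (map_poly \<phi> (p + q)) x = poly (map_poly \<phi> p) x + poly (map_poly \<phi> q) x" for p q
  proof -
    have "map_poly \<phi> (p + q) = map_poly \<phi> p + map_poly \<phi> q"
      by (rule poly_eqI) (simp add: coeff_map_poly simps)
    thus ?thesis by simp
  qed
  have smult: "poly (map_poly \<phi> (smult c q)) x = \<phi> c * poly (map_poly \<phi> q) x" for c q
  proof -
    have "map_poly \<phi> (smult c q) = smult (\<phi> c) (map_poly \<phi> q)"
      by (rule poly_eqI) (simp add: coeff_map_poly simps)
    thus ?thesis by simp
  qed
  show "poly (map_poly \<phi> (p * q)) x = poly (map_poly \<phi> p) x * poly (map_poly \<phi> q) x" for p q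
    by (induction p)
      (simp_all add: add smult eval_map_poly_pCons[OF assms] simps algebra_simps)
qed

lemma hom_eval_map_poly:
  assumes "is_hom \<phi>" "is_hom \<iota>"
  shows "\<phi> (poly (map_poly \<iota> p) x) = poly (map_poly (\<lambda>c. \<phi> (\<iota> c)) p) (\<phi> x)"
proof (induction p)
  case 0
  show ?case using assms by (simp add: is_hom_zero)
next
  case (pCons c p)
  have "is_hom (\<lambda>c. \<phi> (\<iota> c))"
    using assms by (auto intro!: is_homI simp: is_hom_simps)
  thus ?case using pCons assms
    by (simp add: eval_map_poly_pCons is_hom_add is_hom_mult)
qed

lemma eval_map_poly_altdef:
  assumes "is_hom \<iota>"
  shows "poly (map_poly \<iota> p) x = (\<Sum>i\<le>degree p. \<iota> (coeff p i) * x ^ i)"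
proof -
  have "poly (map_poly \<iota> p) x =
      (\<Sum>i\<le>degree (map_poly \<iota> p). coeff (map_poly \<iota> p) i * x ^ i)"
    by (rule poly_altdef)
  also have "\<dots> = (\<Sum>i\<le>degree p. coeff (map_poly \<iota> p) i * x ^ i)"
    using is_hom_zero[OF assms]
    by (intro sum.mono_neutral_left)
      (auto simp: coeff_map_poly coeff_eq_0 not_le intro!: degree_le elim!: order_trans)
  finally show ?thesis
    using assms by (simp add: coeff_map_poly is_hom_zero)
qed

lemma is_hom_subst3 [simp]:
  assumes "is_hom \<iota>"
  shows "is_hom (\<lambda>f. subst3 \<iota> f x y z)"
  unfolding subst3_def by (intro is_hom_eval assms)

lemmas subst3_hom_simps = is_hom_simps[OF is_hom_subst3]

text \<open>Naturality of substitution. Evaluating at a point, restricting to a germ or a line, and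
  composing with H are all instances, so none of them needs the coefficients of
  \<open>f\<close>.\<close>

lemma hom_subst3:
  assumes "is_hom \<phi>" "is_hom \<iota>"
  shows "\<phi> (subst3 \<iota> f x y z) = subst3 (\<lambda>k. \<phi> (\<iota> k)) f (\<phi> x) (\<phi> y) (\<phi> z)"
  unfolding subst3_def by (simp add: hom_eval_map_poly is_hom_eval assms)

lemma
  assumes "is_hom \<iota>"
  shows subst3_const3: "subst3 \<iota> (const3 k) x y z = \<iota> k"
    and subst3_var_a: "subst3 \<iota> var_a x y z = x"
    and subst3_var_b: "subst3 \<iota> var_b x y z = y"
    and subst3_var_c: "subst3 \<iota> var_c x y z = z"
  using is_hom_zero[OF assms] is_hom_one[OF assms]
  by (simp_all add: subst3_def const3_def var_a_def var_b_def var_c_def map_poly_pCons)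

lemmas subst3_simps =
  subst3_hom_simps subst3_const3 subst3_var_a subst3_var_b subst3_var_c

lemma subst3_subst3:
  assumes "is_hom \<iota>"
  shows "subst3 \<iota> (subst3 const3 f u v w) x y z =
    subst3 \<iota> f (subst3 \<iota> u x y z) (subst3 \<iota> v x y z) (subst3 \<iota> w x y z)"
  using hom_subst3[OF is_hom_subst3[OF assms] is_hom_const3, of f u v w x y z]
  by (simp add: subst3_const3 assms)

abbreviation eval3 :: "poly3 \<Rightarrow> complex \<Rightarrow> complex \<Rightarrow> complex \<Rightarrow> complex" where
  "eval3 \<equiv> subst3 (\<lambda>k. k)"

abbreviation curve3 ::
    "poly3 \<Rightarrow> complex poly \<Rightarrow> complex poly \<Rightarrow> complex poly \<Rightarrow> complex poly" where
  "curve3 \<equiv> subst3 (\<lambda>k. [:k:])"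

lemma poly_curve3:
  "poly (curve3 f u v w) t = eval3 f (poly u t) (poly v t) (poly w t)"
  using hom_subst3[of "\<lambda>p. poly p t" "\<lambda>k. [:k:]" f u v w] by simp

lemma eval3_heron_pullback:
  "eval3 (heron_pullback f) x y z = eval3 f (x * z) (y ^ 2 - x ^ 2) (y * z)"
  by (simp add: heron_pullback_def subst3_subst3 subst3_simps)

lemma curve3_heron_pullback:
  "curve3 (heron_pullback f) x y z = curve3 f (x * z) (y ^ 2 - x ^ 2) (y * z)"
  by (simp add: heron_pullback_def subst3_subst3 subst3_simps)

subsection \<open>Homogeneity\<close>

lemma subst3_altdef:
  assumes "is_hom \<iota>"
  shows "subst3 \<iota> f x y z =
    (\<Sum>k\<le>degree f. \<Sum>j\<le>degree (coeff f k). \<Sum>i\<le>degree (coeff (coeff f k) j).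
      \<iota> (coeff (coeff (coeff f k) j) i) * (x ^ i * y ^ j * z ^ k))"
  unfolding subst3_def
  by (subst eval_map_poly_altdef, intro is_hom_eval assms)+
    (simp add: eval_map_poly_altdef assms sum_distrib_right mult.assoc)

lemma homogeneous3_subst3:
  assumes "homogeneous3 d f" "is_hom \<iota>"
  shows "subst3 \<iota> f (r * x) (r * y) (r * z) = r ^ d * subst3 \<iota> f x y z"
proof -
  have "\<iota> (coeff (coeff (coeff f k) j) i) * ((r * x) ^ i * (r * y) ^ j * (r * z) ^ k) =
      r ^ d * (\<iota> (coeff (coeff (coeff f k) j) i) * (x ^ i * y ^ j * z ^ k))" for i j k
  proof (cases "coeff (coeff (coeff f k) j) i = 0")
    case True
    thus ?thesis using assms(2) by (simp add: is_hom_zero)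
  next
    case False
    hence "d = i + j + k"
      using assms(1) by (auto simp: homogeneous3_def)
    thus ?thesis by (simp add: power_mult_distrib power_add mult_ac)
  qed
  thus ?thesis
    by (simp add: subst3_altdef[OF assms(2)] sum_distrib_left)
qed

lemma coeff_eval_map_poly_linear:
  fixes \<iota> :: "'r::comm_ring_1 \<Rightarrow> 's::comm_ring_1"
  assumes "is_hom \<iota>"
  shows "coeff (poly (map_poly (\<lambda>c. [:\<iota> c:]) p) [:0, r:]) n = r ^ n * \<iota> (coeff p n)"
proof -
  have "is_hom (\<lambda>c. [:\<iota> c:])"
    using assms by (auto intro!: is_homI simp: is_hom_simps one_pCons)
  from eval_map_poly_pCons[OF this] show ?thesis
    by (induction p arbitrary: n)
      (auto simp: coeff_pCons is_hom_zero[OF assms] split: nat.splits)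
qed

text \<open>The nested evaluations are peeled off one variable at a time: \<open>A\<close> scales a
  over \<complex> and \<open>B\<close> scales a and b, so that
  \<open>coeff_eval_map_poly_linear\<close> applies at each level over the right coefficient
  ring.\<close>

lemma coeff_subst3_scale:
  "coeff (coeff (coeff (subst3 const3 f (const3 r * var_a) (const3 r * var_b) (const3 r * var_c)) k) j) i
     = r ^ (i + j + k) * coeff (coeff (coeff f k) j) i"
proof -
  define A where "A = (\<lambda>h. poly (map_poly (\<lambda>c::complex. [:c:]) h) [:0, r:])"
  define B where "B = (\<lambda>g. poly (map_poly (\<lambda>h. [:A h:]) g) [:0, [:r:]:])"
  have A: "is_hom A"
    unfolding A_def by (intro is_hom_eval) simp
  have A': "is_hom (\<lambda>h. [:A h:])"
    by (intro is_homI) (simp_all add: is_hom_simps[OF A] pCons_one)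
  have B: "is_hom B"
    unfolding B_def by (intro is_hom_eval A')
  have B': "is_hom (\<lambda>g. [:B g:])"
    by (intro is_homI) (simp_all add: is_hom_simps[OF B] pCons_one)
  have hom: "is_hom (\<lambda>p. [:[:p:]:])" for p :: "complex poly"
    by (auto intro!: is_homI simp: one_pCons)
  have 1: "poly (map_poly const3 h) (const3 r * var_a) = [:[:A h:]:]" for h
    unfolding A_def using hom_eval_map_poly[OF hom is_hom_pconst, of h "[:0, r:]"]
    by (simp add: const3_def[abs_def] var_a_def)
  have 2: "poly (map_poly (\<lambda>h. [:[:A h:]:]) g) (const3 r * var_b) = [:B g:]" for g
    unfolding B_def
    using hom_eval_map_poly[OF is_hom_pconst A', of g "[:0, [:r:]:]"]
    by (simp add: const3_def var_b_def)
  have "subst3 const3 f (const3 r * var_a) (const3 r * var_b) (const3 r * var_c) =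
      poly (map_poly (\<lambda>g. [:B g:]) f) [:0, [:[:r:]:]:]"
    unfolding subst3_def 1 2 by (simp add: const3_def var_c_def)
  hence "coeff (subst3 const3 f (const3 r * var_a) (const3 r * var_b) (const3 r * var_c)) k
      = [:[:r ^ k:]:] * B (coeff f k)"
    by (simp only: coeff_eval_map_poly_linear[OF B] poly_const_pow)
  moreover have "coeff (B g) j = [:r ^ j:] * A (coeff g j)" for g
    unfolding B_def by (simp only: coeff_eval_map_poly_linear[OF A] poly_const_pow)
  moreover have "coeff (A h) i = r ^ i * coeff h i" for h
    unfolding A_def using coeff_eval_map_poly_linear[OF is_hom_id] .
  ultimately show ?thesis
    by (simp add: power_add mult_ac)
qed

text \<open>The single factor 2 detects the degree because its powers are pairwise distinct in
  \<complex>. Homogeneity becomes one ring identity, and its closure and cancellation properties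
  become algebra.\<close>

lemma homogeneous3_iff_scale:
  "homogeneous3 d f \<longleftrightarrow>
    subst3 const3 f (const3 2 * var_a) (const3 2 * var_b) (const3 2 * var_c) = const3 2 ^ d * f"
proof -
  have "const3 2 ^ d * f = smult (smult (smult (2 ^ d) 1) 1) f" for f
  proof -
    have "const3 2 ^ d = [:[:[:2 ^ d:]:]:]"
      by (simp add: const3_def poly_const_pow)
    thus ?thesis by (simp add: one_pCons)
  qed
  hence "(subst3 const3 f (const3 2 * var_a) (const3 2 * var_b) (const3 2 * var_c) = const3 2 ^ d * f)
      \<longleftrightarrow> (\<forall>k j i. 2 ^ (i + j + k) * coeff (coeff (coeff f k) j) i
            = 2 ^ d * coeff (coeff (coeff f k) j) i)"
    by (simp add: poly_eq_iff coeff_subst3_scale)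
  also have "\<dots> \<longleftrightarrow> homogeneous3 d f"
  proof -
    have "(2::complex) ^ m = 2 ^ n \<longleftrightarrow> m = n" for m n :: nat
    proof
      assume "(2::complex) ^ m = 2 ^ n"
      hence "(of_nat (2 ^ m) :: complex) = of_nat (2 ^ n)" by simp
      hence "(2::nat) ^ m = 2 ^ n" by (simp only: of_nat_eq_iff)
      thus "m = n" by simp
    qed simp
    hence "2 ^ m * x = 2 ^ n * x \<longleftrightarrow> (x \<noteq> 0 \<longrightarrow> m = n)" for m n and x :: complex
      by auto
    thus ?thesis
      unfolding homogeneous3_def by blast
  qed
  finally show ?thesis ..
qed

lemma const3_1 [simp]: "const3 1 = 1"
  using is_hom_one[OF is_hom_const3] .

lemma const3_eq_0_iff [simp]: "const3 k = 0 \<longleftrightarrow> k = 0"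
  by (simp add: const3_def)

lemma homogeneous3_cancel:
  assumes "homogeneous3 d g" "homogeneous3 (d + e) (g * h)" "g \<noteq> 0"
  shows "homogeneous3 e h"
proof -
  define S where "S f = subst3 const3 f (const3 2 * var_a) (const3 2 * var_b) (const3 2 * var_c)" for f
  have "S (g * h) = S g * S h"
    unfolding S_def by (simp add: subst3_hom_simps)
  hence "const3 2 ^ (d + e) * (g * h) = const3 2 ^ d * g * S h"
    using assms(1,2) unfolding homogeneous3_iff_scale S_def by simp
  hence "(const3 2 ^ d * g) * (const3 2 ^ e * h - S h) = 0"
    by (simp add: algebra_simps power_add)
  hence "S h = const3 2 ^ e * h"
    using assms(3) by simp
  thus ?thesis
    by (simp add: homogeneous3_iff_scale S_def)
qed

lemma homogeneous3_mult:
  assumes "homogeneous3 d g" "homogeneous3 e h"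
  shows "homogeneous3 (d + e) (g * h)"
  using assms by (simp add: homogeneous3_iff_scale subst3_hom_simps power_add mult_ac)

lemma homogeneous3_power:
  assumes "homogeneous3 d g"
  shows "homogeneous3 (n * d) (g ^ n)"
  using assms by (simp add: homogeneous3_iff_scale subst3_hom_simps power_mult_distrib power_mult mult.commute)

lemma homogeneous3_diff:
  assumes "homogeneous3 d g" "homogeneous3 d h"
  shows "homogeneous3 d (g - h)"
  using assms by (simp add: homogeneous3_iff_scale subst3_hom_simps algebra_simps)

lemma homogeneous3_add:
  assumes "homogeneous3 d g" "homogeneous3 d h"
  shows "homogeneous3 d (g + h)"
  using assms by (simp add: homogeneous3_iff_scale subst3_hom_simps algebra_simps)

lemma homogeneous3_var:
  "homogeneous3 1 var_a" "homogeneous3 1 var_b" "homogeneous3 1 var_c"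
  by (simp_all add: homogeneous3_iff_scale subst3_simps)

lemma homogeneous3_const3: "homogeneous3 0 (const3 k)"
  by (simp add: homogeneous3_iff_scale subst3_simps)

lemma homogeneous3_subst3_forms:
  assumes "homogeneous3 d f" "homogeneous3 e u" "homogeneous3 e v" "homogeneous3 e w"
  shows "homogeneous3 (e * d) (subst3 const3 f u v w)"
proof -
  have "subst3 const3 g (const3 2 * var_a) (const3 2 * var_b) (const3 2 * var_c) = const3 2 ^ e * g"
    if "homogeneous3 e g" for g
    using that by (simp add: homogeneous3_iff_scale)
  hence "subst3 const3 (subst3 const3 f u v w) (const3 2 * var_a) (const3 2 * var_b) (const3 2 * var_c)
      = subst3 const3 f (const3 2 ^ e * u) (const3 2 ^ e * v) (const3 2 ^ e * w)"
    using assms(2-4) by (simp add: subst3_subst3)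
  also have "\<dots> = const3 2 ^ (e * d) * subst3 const3 f u v w"
    by (simp add: homogeneous3_subst3[OF assms(1)] power_mult)
  finally show ?thesis
    by (simp add: homogeneous3_iff_scale)
qed

lemma homogeneous3_heron_pullback:
  assumes "homogeneous3 d f"
  shows "homogeneous3 (2 * d) (heron_pullback f)"
proof -
  have "homogeneous3 2 (u * v)" if "homogeneous3 1 u" "homogeneous3 1 v" for u v
    using homogeneous3_mult[OF that] by (simp add: numeral_2_eq_2)
  note * = this[OF homogeneous3_var(1,1)] this[OF homogeneous3_var(2,2)]
    this[OF homogeneous3_var(1,3)] this[OF homogeneous3_var(2,3)]
  show ?thesis
    unfolding heron_pullback_def power2_eq_square
    by (intro homogeneous3_subst3_forms assms homogeneous3_diff *)
qed

subsection \<open>Polynomials as functions\<close>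

lemma complex_poly_eqI:
  fixes p :: "complex poly"
  assumes "finite A" "\<And>x. x \<notin> A \<Longrightarrow> poly p x = 0"
  shows "p = 0"
proof (rule ccontr)
  assume "p \<noteq> 0"
  hence "finite ({x. poly p x = 0} \<union> A)"
    using assms(1) by (simp add: poly_roots_finite)
  moreover have "{x. poly p x = 0} \<union> A = UNIV"
    using assms(2) by auto
  ultimately show False
    by (simp add: infinite_UNIV_char_0)
qed

text \<open>Removes one variable from a vanishing statement: \<phi> evaluates the inner variables
  while the outermost one ranges freely. The finite exceptional set allows values such as 0 to be
  left out.\<close>

lemma hom_coeff_eq_0:
  fixes \<phi> :: "'r::comm_ring_1 \<Rightarrow> complex"
  assumes "is_hom \<phi>" "finite A" "\<And>x. x \<notin> A \<Longrightarrow> poly (map_poly \<phi> p) x = 0"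
  shows "\<phi> (coeff p n) = 0"
proof -
  have "map_poly \<phi> p = 0"
    by (rule complex_poly_eqI[OF assms(2)]) (use assms in auto)
  hence "coeff (map_poly \<phi> p) n = 0" by simp
  thus ?thesis using assms(1) by (simp add: coeff_map_poly is_hom_zero)
qed

lemma eval3_eq_0D:
  assumes "\<And>x y z. eval3 f x y z = 0"
  shows "f = 0"
proof -
  note one_level = hom_coeff_eq_0[where A = "{}", OF _ finite.emptyI]
  have "coeff (coeff (coeff f k) j) i = 0" for i j k
  proof -
    have "poly (map_poly (\<lambda>h. poly (map_poly (\<lambda>k. k) h) x) (coeff f k)) y = 0" for x y
      by (rule one_level[where \<phi> = "\<lambda>g. poly (map_poly (\<lambda>h. poly (map_poly (\<lambda>k. k) h) x) g) y"])
        (use assms in \<open>simp_all add: subst3_def is_hom_eval\<close>)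
    hence "poly (map_poly (\<lambda>k. k) (coeff (coeff f k) j)) x = 0" for x
      by (intro one_level[where \<phi> = "\<lambda>h. poly (map_poly (\<lambda>k. k) h) x"])
        (simp_all only: is_hom_eval is_hom_id)
    thus ?thesis
      by (intro one_level[where \<phi> = "\<lambda>k. k"]) (simp_all only: is_hom_id)
  qed
  thus ?thesis by (simp add: poly_eq_iff)
qed

lemma eval3_nonzeroE:
  assumes "f \<noteq> 0"
  obtains x y z where "eval3 f x y z \<noteq> 0"
  using assms eval3_eq_0D by blast

text \<open>Each coefficient in c has the root b = \<epsilon> a over the ring of polynomials in a.
  Points with x = 0 or z = 0 are left out of the hypothesis because the local study of the pullback
  rescales by x z.\<close>

lemma linear_form_dvd:
  assumes "\<And>x z. x \<noteq> 0 \<Longrightarrow> z \<noteq> 0 \<Longrightarrow> eval3 h x (\<epsilon> * x) z = 0"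
  shows "var_b - const3 \<epsilon> * var_a dvd h"
proof -
  have root: "poly (coeff h k) [:0, \<epsilon>:] = 0" for k
  proof (rule complex_poly_eqI[of "{0}"])
    fix x :: complex assume "x \<notin> {0}"
    define \<phi> where "\<phi> g = poly (map_poly (\<lambda>h. poly (map_poly (\<lambda>k. k) h) x) g) (\<epsilon> * x)" for g
    have hom: "is_hom \<phi>"
      unfolding \<phi>_def by (intro is_hom_eval is_hom_id)
    have "poly (map_poly \<phi> h) z = 0" if "z \<notin> {0}" for z
      using assms[of x z] \<open>x \<notin> {0}\<close> that by (simp only: subst3_def \<phi>_def[abs_def]) simp
    hence "\<phi> (coeff h k) = 0"
      by (intro hom_coeff_eq_0[OF hom, of "{0}"]) auto
    moreover have "poly (poly g [:0, \<epsilon>:]) x = \<phi> g" for g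
      using hom_eval_map_poly[OF is_hom_poly is_hom_id, of g "[:0, \<epsilon>:]" x]
      by (simp add: \<phi>_def mult.commute)
    ultimately show "poly (poly (coeff h k) [:0, \<epsilon>:]) x = 0" by simp
  qed simp
  have "[:[:- [:0, \<epsilon>:], 1:]:] dvd h"
    unfolding const_poly_dvd_iff using root by (simp add: poly_eq_0_iff_dvd)
  also have "[:[:- [:0, \<epsilon>:], 1:]:] = var_b - const3 \<epsilon> * var_a"
    by (simp add: var_b_def const3_def var_a_def)
  finally show ?thesis .
qed

subsection \<open>Chebyshev polynomials\<close>

text \<open>The index of the second kind is shifted so that \<open>cheb_S n (cos \<theta>) = sin (n \<theta>) / sin \<theta>\<close>.\<close>

definition cheb_S :: "nat \<Rightarrow> complex poly" where
  "cheb_S n = (case n of 0 \<Rightarrow> 0 | Suc m \<Rightarrow> cheb_U m)"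

text \<open>The Chebyshev polynomials of the first kind,
  \<open>cheb_T n (cos \<theta>) = cos (n \<theta>)\<close>. Together with t^2 - 1 in the role of
  -sin^2 \<theta>, they turn the trigonometric identities into polynomial ones.\<close>

definition cheb_T :: "nat \<Rightarrow> complex poly" where
  "cheb_T n = cheb_S (Suc n) - [:0, 1:] * cheb_S n"

definition cheb_D :: "complex poly" where
  "cheb_D = [:0, 1:] ^ 2 - 1"

lemma cheb_U_eq_S: "n > 0 \<Longrightarrow> cheb_U (n - 1) = cheb_S n"
  by (cases n) (auto simp: cheb_S_def)

lemma cheb_S_0 [simp]: "cheb_S 0 = 0"
  and cheb_S_1 [simp]: "cheb_S (Suc 0) = 1"
  by (simp_all add: cheb_S_def)

lemma cheb_T_0 [simp]: "cheb_T 0 = 1"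
  by (simp add: cheb_T_def)

lemma cheb_S_Suc: "cheb_S (Suc n) = [:0, 1:] * cheb_S n + cheb_T n"
  by (simp add: cheb_T_def)

lemma cheb_S_Suc_Suc: "cheb_S (Suc (Suc n)) = 2 * [:0, 1:] * cheb_S (Suc n) - cheb_S n"
  by (cases n) (simp_all add: cheb_S_def numeral_poly)

lemma cheb_T_Suc: "cheb_T (Suc n) = [:0, 1:] * cheb_T n + cheb_D * cheb_S n"
proof -
  have "cheb_T (Suc n) = [:0, 1:] * cheb_S (Suc n) - cheb_S n"
    unfolding cheb_T_def cheb_S_Suc_Suc by (simp only: algebra_simps mult_2)
  thus ?thesis
    unfolding cheb_S_Suc cheb_D_def by (simp only: algebra_simps power2_eq_square mult_1)
qed

lemma cheb_T_1: "cheb_T (Suc 0) = [:0, 1:]"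
  by (simp add: cheb_T_Suc)

lemma cheb_S_T_add:
  "cheb_S (m + n) = cheb_S m * cheb_T n + cheb_T m * cheb_S n \<and>
   cheb_T (m + n) = cheb_T m * cheb_T n + cheb_D * cheb_S m * cheb_S n"
proof (induction m)
  case (Suc m)
  thus ?case
    by (simp only: add_Suc cheb_S_Suc cheb_T_Suc) (simp only: algebra_simps)
qed simp

lemmas cheb_S_add = cheb_S_T_add[THEN conjunct1]
lemmas cheb_T_add = cheb_S_T_add[THEN conjunct2]

lemma cheb_pell: "cheb_T n ^ 2 = 1 + cheb_D * cheb_S n ^ 2"
proof (induction n)
  case (Suc n)
  have *: "T\<^sup>2 = 1 + D * S\<^sup>2 \<Longrightarrow> D = X\<^sup>2 - 1 \<Longrightarrow> (X * T + D * S)\<^sup>2 = 1 + D * (X * S + T)\<^sup>2"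
    for X T D S :: "complex poly" by algebra
  show ?case
    unfolding cheb_S_Suc cheb_T_Suc by (rule *[OF Suc]) (simp add: cheb_D_def)
qed simp

text \<open>With n = k + m the addition formulas are a linear system for the values at k; its
  determinant \<open>T'\<^sup>2 - D * S'\<^sup>2\<close> is 1 by \<open>cheb_pell\<close>.\<close>

lemma
  assumes "m \<le> n"
  shows cheb_S_diff: "cheb_S (n - m) = cheb_S n * cheb_T m - cheb_T n * cheb_S m"
    and cheb_T_diff: "cheb_T (n - m) = cheb_T n * cheb_T m - cheb_D * cheb_S n * cheb_S m"
proof -
  define k where "k = n - m"
  have n: "n = k + m" using assms by (simp add: k_def)
  have "S = (S * T' + T * S') * T' - (T * T' + D * S * S') * S'"
    "T = (T * T' + D * S * S') * T' - D * (S * T' + T * S') * S'"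
    if "T'\<^sup>2 = 1 + D * S'\<^sup>2" for T S D T' S' :: "complex poly"
    using that by algebra+
  from this[OF cheb_pell[of m]]
  show "cheb_S (n - m) = cheb_S n * cheb_T m - cheb_T n * cheb_S m"
    "cheb_T (n - m) = cheb_T n * cheb_T m - cheb_D * cheb_S n * cheb_S m"
    unfolding n cheb_S_add cheb_T_add by (simp_all only: diff_add_inverse2)
qed

lemma cheb_S_square_diff:
  "cheb_S (m + n) ^ 2 - cheb_S m ^ 2 = cheb_S (m + (m + n)) * cheb_S n"
proof -
  have "(S * T' + T * S')\<^sup>2 - S\<^sup>2 = (S * (T * T' + D * S * S') + T * (S * T' + T * S')) * S'"
    if "T'\<^sup>2 = 1 + D * S'\<^sup>2" for T S D T' S' :: "complex poly"
    using that by algebra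
  from this[OF cheb_pell[of n]] show ?thesis
    unfolding cheb_S_add cheb_T_add .
qed

lemma poly_cheb_1: "poly (cheb_S n) 1 = of_nat n \<and> poly (cheb_T n) 1 = 1"
  by (induction n) (simp_all add: cheb_S_Suc cheb_T_Suc cheb_D_def)

lemma degree_cheb_U: "degree (cheb_U n) = n"
proof -
  have "degree (cheb_U n) \<le> n \<and> coeff (cheb_U n) n = 2 ^ n"
  proof (induction n rule: cheb_U.induct)
    case (3 n)
    have "degree ([:0, 2:] * cheb_U (Suc n)) \<le> Suc (Suc n)"
      using 3 by (intro order_trans[OF degree_mult_le]) auto
    moreover have "degree (cheb_U n) \<le> Suc (Suc n)" "coeff (cheb_U n) (Suc (Suc n)) = 0"
      using 3 by (auto intro: coeff_eq_0)
    ultimately show ?case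
      using 3 by (auto intro: degree_diff_le)
  qed auto
  thus ?thesis
    using le_degree[of "cheb_U n" n] by auto
qed

lemma degree_cheb_S: "degree (cheb_S n) = n - 1"
  by (cases n) (simp_all add: cheb_S_def degree_cheb_U)

lemma cheb_S_nonzero: "n > 0 \<Longrightarrow> cheb_S n \<noteq> 0"
  using poly_cheb_1[of n] by (metis of_nat_eq_0_iff poly_0 not_gr_zero)

text \<open>The \<theta>-derivatives of cos (n\<theta>) and sin (n\<theta>) / sin \<theta>,
  rewritten in t = cos \<theta>; the second is multiplied by \<open>cheb_D\<close> to stay
  polynomial.\<close>

lemma pderiv_cheb:
  "pderiv (cheb_T n) = of_nat n * cheb_S n \<and>
   cheb_D * pderiv (cheb_S n) = of_nat n * cheb_T n - [:0, 1:] * cheb_S n"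
proof (induction n)
  case 0
  show ?case by simp
next
  case (Suc n)
  have X: "pderiv [:0, 1:] = (1::complex poly)"
    by (simp add: pderiv_pCons one_pCons)
  have D: "pderiv cheb_D = 2 * [:0, 1:]"
    unfolding cheb_D_def power2_eq_square pderiv_diff pderiv_mult X by (simp add: numeral_poly)
  let ?S = "cheb_S n" let ?T = "cheb_T n" let ?X = "[:0, 1:] :: complex poly"
  have "pderiv (cheb_T (Suc n)) = ?T + ?X * (of_nat n * ?S) + 2 * ?X * ?S + cheb_D * pderiv ?S"
    unfolding cheb_T_Suc pderiv_add pderiv_mult X D using Suc by (simp only: algebra_simps mult_1)
  also have "\<dots> = of_nat (Suc n) * cheb_S (Suc n)"
    unfolding Suc[THEN conjunct2] cheb_S_Suc of_nat_Suc by (simp only: algebra_simps mult_1 mult_2)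
  finally have 1: "pderiv (cheb_T (Suc n)) = of_nat (Suc n) * cheb_S (Suc n)" .
  have "cheb_D * pderiv (cheb_S (Suc n)) =
      cheb_D * ?S + ?X * (cheb_D * pderiv ?S) + cheb_D * pderiv ?T"
    unfolding cheb_S_Suc pderiv_add pderiv_mult X by (simp only: algebra_simps mult_1)
  also have "\<dots> = cheb_D * ?S + ?X * (of_nat n * ?T - ?X * ?S) + cheb_D * (of_nat n * ?S)"
    using Suc by simp
  also have "\<dots> = of_nat (Suc n) * cheb_T (Suc n) - ?X * cheb_S (Suc n)"
    unfolding cheb_S_Suc cheb_T_Suc cheb_D_def of_nat_Suc
    by (simp only: algebra_simps mult_1 power2_eq_square)
  finally show ?case using 1 by blast
qed

text \<open>The subtractive Euclidean algorithm, applied to properties of an index: common roots of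
  the \<open>cheb_S n\<close>, and agreement of two parameters.\<close>

lemma nat_coprime_descent:
  fixes m n :: nat
  assumes "P m" "P n" "coprime m n" "m > 0" "n > 0"
    and diff: "\<And>i j. P i \<Longrightarrow> P j \<Longrightarrow> 0 < j \<Longrightarrow> j < i \<Longrightarrow> P (i - j)"
  shows "P 1"
  using assms(1-5)
proof (induction "m + n" arbitrary: m n rule: less_induct)
  case less
  consider "m = n" | "m < n" | "n < m" by linarith
  thus ?case
  proof cases
    case 1
    thus ?thesis using less.prems by simp
  next
    case 2
    have "coprime m (n - m)"
      using 2 less.prems gcd_diff1_nat[of m n]
      by (simp add: coprime_iff_gcd_eq_1 gcd.commute[of m])
    thus ?thesis
      using less.hyps[of m "n - m"] less.prems 2 diff[of n m] by simp
  next
    case 3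
    have "coprime (m - n) n"
      using 3 less.prems by (simp add: coprime_iff_gcd_eq_1 gcd_diff1_nat)
    thus ?thesis
      using less.hyps[of "m - n" n] less.prems 3 diff[of m n] by simp
  qed
qed

lemma cheb_S_no_common_root:
  assumes "coprime m n" "m > 0" "n > 0" "poly (cheb_S m) t = 0"
  shows "poly (cheb_S n) t \<noteq> 0"
proof
  assume "poly (cheb_S n) t = 0"
  hence "poly (cheb_S 1) t = 0"
    using assms by (intro nat_coprime_descent[of "\<lambda>n. poly (cheb_S n) t = 0" m n]) (auto simp: cheb_S_diff)
  thus False by simp
qed

subsection \<open>Order of vanishing along curve germs\<close>

text \<open>The order is tested along all polynomial germs through a representative in \<complex>^3,
  not read off from Taylor coefficients in a chart, because pulling back by H then just replaces one
  germ by another.\<close>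

definition vanishes_to_order :: "nat \<Rightarrow> poly3 \<Rightarrow> complex \<Rightarrow> complex \<Rightarrow> complex \<Rightarrow> bool" where
  "vanishes_to_order m f x y z \<longleftrightarrow>
    (\<forall>u v w. poly u 0 = x \<longrightarrow> poly v 0 = y \<longrightarrow> poly w 0 = z \<longrightarrow> [:0, 1:] ^ m dvd curve3 f u v w)"

lemma X_power_dvd_iff: "[:0, 1:] ^ m dvd (p :: 'a::idom poly) \<longleftrightarrow> (\<forall>k<m. coeff p k = 0)"
  using monom_1_dvd_iff'[of m p] by (simp add: monom_altdef)

lemma vanishes_to_orderD:
  "vanishes_to_order m f (poly u 0) (poly v 0) (poly w 0) \<Longrightarrow> [:0, 1:] ^ m dvd curve3 f u v w"
  by (simp add: vanishes_to_order_def)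

lemma vanishes_to_order_0 [simp]: "vanishes_to_order 0 f x y z"
  by (simp add: vanishes_to_order_def)

text \<open>A generic line through the point detects the order: the Taylor coefficients of \<open>f\<close> along
  \<open>s \<mapsto> (x, y, z) + s (a, b, c)\<close> are polynomials in \<open>a, b, c\<close>.\<close>

lemma vanishes_to_order_lines:
  assumes "h \<noteq> 0"
    and "\<And>a b c. eval3 h a b c \<noteq> 0 \<Longrightarrow> [:0, 1:] ^ m dvd curve3 f [:x, a:] [:y, b:] [:z, c:]"
  shows "vanishes_to_order m f x y z"
proof -
  \<comment> \<open>The line through the point with indeterminate direction (a, b, c): the
    coefficients of \<open>F\<close> are polynomials in the direction, and \<psi> below specialises
    the direction to u, v, w, which may depend on s.\<close>
  define F where
    "F = subst3 (\<lambda>k. [:const3 k:]) f [:const3 x, var_a:] [:const3 y, var_b:] [:const3 z, var_c:]"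
  define \<psi> where "\<psi> u v w G = poly (map_poly (\<lambda>g. curve3 g u v w) G) [:0, 1:]"
    for u v w and G :: "poly3 poly"
  have hom: "is_hom (\<psi> u v w)" for u v w
    unfolding \<psi>_def[abs_def] by (intro is_hom_eval is_hom_subst3 is_hom_pconst)
  have \<psi>_pCons: "\<psi> u v w (pCons g G) = curve3 g u v w + [:0, 1:] * \<psi> u v w G" for u v w g G
    unfolding \<psi>_def by (intro eval_map_poly_pCons is_hom_subst3 is_hom_pconst)
  have \<psi>_0: "\<psi> u v w 0 = 0" for u v w
    using is_hom_zero[OF hom] .
  have \<psi>_F: "\<psi> u v w F = curve3 f ([:x:] + [:0, 1:] * u) ([:y:] + [:0, 1:] * v) ([:z:] + [:0, 1:] * w)"
    for u v w
    unfolding F_def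
    by (subst hom_subst3[OF hom is_hom_pconst_const3]) (simp add: \<psi>_pCons \<psi>_0 subst3_simps)
  have "coeff F k = 0" if "k < m" for k
  proof -
    \<comment> \<open>The factor \<open>h\<close> kills the directions about which nothing is
      assumed.\<close>
    have "eval3 (h * coeff F k) a b c = 0" for a b c
    proof (cases "eval3 h a b c = 0")
      case True
      thus ?thesis by (simp add: subst3_hom_simps)
    next
      case False
      have "curve3 g [:a:] [:b:] [:c:] = [:eval3 g a b c:]" for g
        using hom_subst3[OF is_hom_pconst is_hom_id, of g a b c] by simp
      hence "\<psi> [:a:] [:b:] [:c:] F = poly (map_poly (\<lambda>g. [:eval3 g a b c:]) F) [:0, 1:]"
        by (simp add: \<psi>_def)
      hence "coeff (\<psi> [:a:] [:b:] [:c:] F) k = eval3 (coeff F k) a b c"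
        by (simp add: coeff_eval_map_poly_linear is_hom_subst3)
      moreover have "coeff (\<psi> [:a:] [:b:] [:c:] F) k = 0"
        using assms(2)[OF False] that by (simp add: \<psi>_F X_power_dvd_iff)
      ultimately show ?thesis by (simp add: subst3_hom_simps)
    qed
    hence "h * coeff F k = 0" by (rule eval3_eq_0D)
    thus ?thesis using assms(1) by simp
  qed
  hence "[:0, 1:] ^ m dvd F"
    by (simp add: X_power_dvd_iff)
  then obtain G where G: "F = [:0, 1:] ^ m * G" ..
  show ?thesis unfolding vanishes_to_order_def
  proof (intro allI impI)
    fix u v w :: "complex poly"
    assume *: "poly u 0 = x" "poly v 0 = y" "poly w 0 = z"
    \<comment> \<open>Every germ is such a line with s-dependent direction: u = x + s u'(s).\<close>
    obtain u' v' w' where "u = pCons x u'" "v = pCons y v'" "w = pCons z w'"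
      using * by (cases u, cases v, cases w) auto
    hence "curve3 f u v w = \<psi> u' v' w' F"
      by (simp add: \<psi>_F)
    also have "\<dots> = [:0, 1:] ^ m * \<psi> u' v' w' G"
      unfolding G is_hom_mult[OF hom] is_hom_power[OF hom] by (simp add: \<psi>_pCons \<psi>_0 subst3_hom_simps)
    finally show "[:0, 1:] ^ m dvd curve3 f u v w" by simp
  qed
qed

lemma vanishes_to_order_scale:
  assumes "homogeneous3 d f" "vanishes_to_order m f x y z" "\<kappa> \<noteq> 0"
  shows "vanishes_to_order m f (\<kappa> * x) (\<kappa> * y) (\<kappa> * z)"
  unfolding vanishes_to_order_def
proof (intro allI impI)
  fix u v w :: "complex poly"
  assume *: "poly u 0 = \<kappa> * x" "poly v 0 = \<kappa> * y" "poly w 0 = \<kappa> * z"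
  define S where "S p = smult (inverse \<kappa>) p" for p :: "complex poly"
  have "curve3 f u v w = curve3 f ([:\<kappa>:] * S u) ([:\<kappa>:] * S v) ([:\<kappa>:] * S w)"
    using assms(3) by (simp add: S_def)
  also have "\<dots> = [:\<kappa>:] ^ d * curve3 f (S u) (S v) (S w)"
    by (rule homogeneous3_subst3[OF assms(1)]) simp
  also have "[:0, 1:] ^ m dvd \<dots>"
  proof (intro dvd_mult vanishes_to_orderD)
    have "poly (S u) 0 = x" "poly (S v) 0 = y" "poly (S w) 0 = z"
      using assms(3) * by (simp_all add: S_def)
    thus "vanishes_to_order m f (poly (S u) 0) (poly (S v) 0) (poly (S w) 0)"
      using assms(2) by simp
  qed
  finally show "[:0, 1:] ^ m dvd curve3 f u v w" .
qed

lemma X_power_dvd_cancel: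
  fixes p q :: "complex poly"
  assumes "[:0, 1:] ^ m dvd p * q" "p = [:0, 1:] ^ k * r" "poly r 0 \<noteq> 0"
  shows "[:0, 1:] ^ (m - k) dvd q"
proof (cases "m \<le> k")
  case False
  hence "[:0, 1:] ^ m = [:0, 1:] ^ k * [:0, 1 :: complex:] ^ (m - k)"
    by (simp flip: power_add)
  hence "[:0, 1:] ^ (m - k) dvd r * q"
    using assms(1,2) by (simp only: mult.assoc dvd_mult_cancel_left) (simp add: power_0_left)
  moreover have "coprime ([:0, 1:] ^ (m - k)) r"
  proof -
    have "\<not> [:- 0, 1:] dvd r"
      using assms(3) poly_eq_0_iff_dvd[of r 0] by simp
    moreover have "prime_elem [:- 0, 1 :: complex:]"
      by (rule prime_elem_linear_field_poly) simp
    ultimately show ?thesis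
      by (simp add: prime_elem_imp_coprime)
  qed
  ultimately show ?thesis
    by (simp add: coprime_dvd_mult_right_iff)
qed simp

subsection \<open>The linear exceptional factors\<close>

lemma linear_form_nonzero: "var_b - const3 \<epsilon> * var_a \<noteq> 0"
proof
  assume "var_b - const3 \<epsilon> * var_a = 0"
  hence "eval3 (var_b - const3 \<epsilon> * var_a) 0 1 0 = eval3 0 0 1 0" by simp
  thus False by (simp add: subst3_simps)
qed

lemma linear_form_dvd_iff:
  "var_b - const3 \<epsilon> * var_a dvd h \<longleftrightarrow> subst3 const3 h var_a (const3 \<epsilon> * var_a) var_c = 0"
proof
  assume "var_b - const3 \<epsilon> * var_a dvd h"
  then obtain g where "h = (var_b - const3 \<epsilon> * var_a) * g" ..
  thus "subst3 const3 h var_a (const3 \<epsilon> * var_a) var_c = 0"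
    by (simp add: subst3_simps)
next
  assume *: "subst3 const3 h var_a (const3 \<epsilon> * var_a) var_c = 0"
  have "eval3 h x (\<epsilon> * x) z = 0" for x z
    using arg_cong[OF *, of "\<lambda>g. eval3 g x 0 z"] by (simp add: subst3_subst3 subst3_simps)
  thus "var_b - const3 \<epsilon> * var_a dvd h"
    by (rule linear_form_dvd)
qed

lemma prime_elem_linear_form: "prime_elem (var_b - const3 \<epsilon> * var_a)"
proof (rule prime_elemI)
  show "\<not> var_b - const3 \<epsilon> * var_a dvd 1"
    by (simp add: linear_form_dvd_iff subst3_simps)
qed (use linear_form_nonzero[of \<epsilon>] in \<open>auto simp: linear_form_dvd_iff subst3_hom_simps\<close>)

text \<open>Split off the exact power k of the linear form L and cross the line L = 0 transversally
  at a point where the cofactor is nonzero. Along this germ L is s, so the pullback has order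
  exactly k; but H maps the germ to one through x z (1, 0, \<epsilon>), which forces order at least
  m.\<close>

lemma linear_form_power_dvd_heron_pullback:
  assumes "\<epsilon>\<^sup>2 = 1" "homogeneous3 d f" "vanishes_to_order m f 1 0 \<epsilon>" "heron_pullback f \<noteq> 0"
  shows "(var_b - const3 \<epsilon> * var_a) ^ m dvd heron_pullback f"
proof -
  define L where "L = var_b - const3 \<epsilon> * var_a"
  define k where "k = multiplicity L (heron_pullback f)"
  have "\<not> L dvd 1"
    using prime_elem_linear_form[of \<epsilon>] by (auto simp: L_def prime_elem_def)
  then obtain h where h: "heron_pullback f = L ^ k * h" "\<not> L dvd h"
    using multiplicity_decompose'[of "heron_pullback f" L] assms(4) by (auto simp: k_def)
  then obtain x z where xz: "x \<noteq> 0" "z \<noteq> 0" "eval3 h x (\<epsilon> * x) z \<noteq> 0"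
    using linear_form_dvd[of h \<epsilon>] by (auto simp: L_def)
  let ?u = "[:x:]" let ?v = "[:\<epsilon> * x, 1:]" let ?w = "[:z:]"
  have "[:0, 1:] ^ m dvd curve3 (heron_pullback f) ?u ?v ?w"
  proof -
    have "vanishes_to_order m f ((x * z) * 1) ((x * z) * 0) ((x * z) * \<epsilon>)"
      using assms xz by (intro vanishes_to_order_scale) auto
    thus ?thesis
      unfolding curve3_heron_pullback using assms(1)
      by (intro vanishes_to_orderD) (simp add: power_mult_distrib mult_ac)
  qed
  moreover have "curve3 (heron_pullback f) ?u ?v ?w = [:0, 1:] ^ k * curve3 h ?u ?v ?w"
    unfolding h(1) L_def by (simp add: subst3_simps)
  ultimately have "[:0, 1:] ^ m dvd curve3 h ?u ?v ?w * [:0, 1:] ^ k"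
    by (simp add: mult.commute)
  hence "[:0, 1:] ^ (m - 0) dvd [:0, 1 :: complex:] ^ k"
    using xz(3) by (intro X_power_dvd_cancel[where k = 0 and r = "curve3 h ?u ?v ?w"]) (auto simp: poly_curve3)
  hence "m \<le> k"
    by (auto dest!: dvd_imp_degree_le simp: degree_power_eq)
  hence "L ^ m dvd L ^ k"
    by (rule le_imp_power_dvd)
  thus ?thesis unfolding h(1) L_def[symmetric] by (rule dvd_mult2)
qed

lemma linear_form_powers_dvd:
  assumes "(var_b + var_a) ^ m dvd g" "(var_b - var_a) ^ n dvd g"
  shows "(var_b + var_a) ^ m * (var_b - var_a) ^ n dvd g"
proof -
  have P: "prime_elem (var_b + var_a)"
    using prime_elem_linear_form[of "- 1"] is_hom_diff[OF is_hom_const3, of 0 1]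
    by (simp add: is_hom_zero[OF is_hom_const3])
  have N: "\<not> var_b + var_a dvd var_b - var_a"
  proof
    assume "var_b + var_a dvd var_b - var_a"
    then obtain h where "var_b - var_a = (var_b + var_a) * h" ..
    from arg_cong[OF this, of "\<lambda>g. eval3 g 1 (- 1) 0"] show False
      by (simp add: subst3_simps)
  qed
  have "coprime ((var_b + var_a) ^ m) ((var_b - var_a) ^ n)"
    using prime_elem_imp_coprime[OF P N] by simp
  thus ?thesis using assms by (simp add: divides_mult)
qed

text \<open>H is dominant: a point with \<open>f\<close> nonzero, chosen off b = 0 and c^2 = a^2,
  has an explicit preimage.\<close>

lemma heron_pullback_nonzero:
  assumes "homogeneous3 d f" "f \<noteq> 0"
  shows "heron_pullback f \<noteq> 0"
proof
  assume 0: "heron_pullback f = 0"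
  have "var_b \<noteq> 0" "var_c ^ 2 - var_a ^ 2 \<noteq> 0"
  proof -
    have "eval3 var_b 0 1 0 \<noteq> 0" "eval3 (var_c ^ 2 - var_a ^ 2) 1 0 0 \<noteq> 0"
      by (simp_all add: subst3_simps)
    thus "var_b \<noteq> 0" "var_c ^ 2 - var_a ^ 2 \<noteq> 0"
      by (metis is_hom_zero[OF is_hom_subst3[OF is_hom_id]])+
  qed
  hence "f * (var_b * (var_c ^ 2 - var_a ^ 2)) \<noteq> 0"
    using assms(2) by simp
  then obtain x y z where "eval3 (f * (var_b * (var_c ^ 2 - var_a ^ 2))) x y z \<noteq> 0"
    by (rule eval3_nonzeroE)
  hence nz: "eval3 f x y z \<noteq> 0" "y \<noteq> 0" "z\<^sup>2 - x\<^sup>2 \<noteq> 0"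
    by (auto simp: subst3_simps)
  \<comment> \<open>H sends (\<kappa> x, \<kappa> z, 1) to (\<kappa> x, \<kappa>^2 (z^2 - x^2),
    \<kappa> z), which is \<kappa> (x, y, z) for this value of \<kappa>.\<close>
  define \<kappa> where "\<kappa> = y / (z\<^sup>2 - x\<^sup>2)"
  have "(\<kappa> * z)\<^sup>2 - (\<kappa> * x)\<^sup>2 = \<kappa> * (\<kappa> * (z\<^sup>2 - x\<^sup>2))"
    by (simp add: algebra_simps power2_eq_square)
  also have "\<dots> = \<kappa> * y"
    using nz by (simp add: \<kappa>_def)
  finally have "eval3 (heron_pullback f) (\<kappa> * x) (\<kappa> * z) 1 = eval3 f (\<kappa> * x) (\<kappa> * y) (\<kappa> * z)"
    by (simp add: eval3_heron_pullback)
  also have "\<dots> = \<kappa> ^ d * eval3 f x y z"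
    by (rule homogeneous3_subst3[OF assms(1)]) simp
  finally show False
    using nz 0 by (simp add: \<kappa>_def subst3_simps)
qed

subsection \<open>Existence by Euclidean descent along the Heron transformation\<close>

text \<open>The induction invariant of the descent. Truncated halves cover all parities at once. G_0
  is absent because its order follows from the last step alone, by homogeneity.\<close>

definition gate_form :: "nat \<Rightarrow> nat \<Rightarrow> poly3 \<Rightarrow> bool" where
  "gate_form p q f \<longleftrightarrow>
     f \<noteq> 0 \<and> homogeneous3 (p + q - 1) f \<and> vanishes_on_param p q f \<and>
     vanishes_to_order ((p - 1) div 2) f 0 1 1 \<and>
     vanishes_to_order (p div 2) f 0 1 (- 1) \<and>
     vanishes_to_order ((q - 1) div 2) f 1 0 1 \<and>
     vanishes_to_order (q div 2) f 1 0 (- 1) \<and>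
     vanishes_to_order ((p + q) div 2) f 1 1 0 \<and>
     vanishes_to_order ((p + q - 1) div 2) f 1 (- 1) 0"

lemma vanishes_on_param_iff:
  assumes "p > 0" "q > 0"
  shows "vanishes_on_param p q f \<longleftrightarrow> curve3 f (cheb_S p) (cheb_S q) (cheb_S (p + q)) = 0"
  using assms by (simp add: vanishes_on_param_def cheb_U_eq_S del: One_nat_def)

text \<open>By \<open>cheb_S_square_diff\<close>, H composed with \<Gamma> for (p, p + q) is
  \<Gamma> for (p, q) times the common factor \<open>cheb_S (p + (p + q))\<close>, which homogeneity
  pulls out.\<close>

lemma vanishes_on_param_heron_pullback:
  assumes "homogeneous3 d f" "vanishes_on_param p q f" "p > 0" "q > 0"
  shows "vanishes_on_param p (p + q) (heron_pullback f)"
proof -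
  have "curve3 (heron_pullback f) (cheb_S p) (cheb_S (p + q)) (cheb_S (p + (p + q))) =
      curve3 f (cheb_S (p + (p + q)) * cheb_S p) (cheb_S (p + (p + q)) * cheb_S q)
        (cheb_S (p + (p + q)) * cheb_S (p + q))"
    by (simp add: curve3_heron_pullback cheb_S_square_diff mult.commute)
  also have "\<dots> = 0"
    using assms by (subst homogeneous3_subst3[OF assms(1)]) (simp_all add: vanishes_on_param_iff)
  finally show ?thesis
    using assms by (simp add: vanishes_on_param_iff)
qed

lemma vanishes_on_param_cancel:
  assumes "vanishes_on_param p q (g * h)" "\<not> vanishes_on_param p q g"
  shows "vanishes_on_param p q h"
  using assms by (simp add: vanishes_on_param_def subst3_hom_simps)

text \<open>The forms b \<plusminus> a are tested at t = 1, where \<open>cheb_S n\<close> takes the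
  value n. The restriction p \<noteq> q is genuine: \<Gamma> for (1, 1) lies on b = a.\<close>

lemma not_vanishes_on_param_linear:
  assumes "p > 0" "q > 0"
  shows "\<not> vanishes_on_param p q var_c"
    and "p \<noteq> q \<Longrightarrow> \<not> vanishes_on_param p q (var_b - var_a)"
    and "\<not> vanishes_on_param p q (var_b + var_a)"
proof -
  have *: "poly (cheb_S n) 1 = of_nat n" for n
    by (simp add: poly_cheb_1)
  show "\<not> vanishes_on_param p q var_c"
    using assms cheb_S_nonzero[of "p + q"] by (simp add: vanishes_on_param_iff subst3_simps)
  have "poly (cheb_S q - cheb_S p) 1 \<noteq> 0" if "p \<noteq> q"
    using that by (simp add: *)
  thus "\<not> vanishes_on_param p q (var_b - var_a)" if "p \<noteq> q"
    using assms that by (auto simp: vanishes_on_param_iff subst3_simps)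
  have "poly (cheb_S q + cheb_S p) 1 = of_nat (p + q)"
    by (simp add: *)
  also have "\<dots> \<noteq> 0"
    using assms by (simp only: of_nat_eq_0_iff)
  finally have "cheb_S q + cheb_S p \<noteq> 0"
    by (metis poly_0)
  thus "\<not> vanishes_on_param p q (var_b + var_a)"
    using assms by (simp add: vanishes_on_param_iff subst3_simps)
qed

lemma not_vanishes_on_param_mult:
  "\<not> vanishes_on_param p q g \<Longrightarrow> \<not> vanishes_on_param p q h \<Longrightarrow> \<not> vanishes_on_param p q (g * h)"
  by (simp add: vanishes_on_param_def subst3_hom_simps)

lemma not_vanishes_on_param_power:
  "\<not> vanishes_on_param p q g \<Longrightarrow> \<not> vanishes_on_param p q (g ^ n)"
  by (simp add: vanishes_on_param_def subst3_hom_simps)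

text \<open>The exponents are the orders of \<open>f'\<close> at F_- and F_+. They sum to r - 1,
  which brings the degree 2(p + r - 1) of the pullback down to p + (p + r) - 1.\<close>

locale heron_step =
  fixes p r :: nat and f' f :: poly3
  assumes pos: "p > 0" "r > 0"
    and f': "gate_form p r f'"
    and pullback: "heron_pullback f' =
      (var_b + var_a) ^ (r div 2) * (var_b - var_a) ^ ((r - 1) div 2) * f"
begin

lemma halves: "r div 2 + (r - 1) div 2 = r - 1" "(p + (p + r)) div 2 = p + r div 2"
  "(p + (p + r) - 1) div 2 = p + (r - 1) div 2"
proof -
  show "r div 2 + (r - 1) div 2 = r - 1" by presburger
  show "(p + (p + r)) div 2 = p + r div 2" by presburger
  have "p + (p + r) - 1 = 2 * p + (r - 1)" using pos by simp
  thus "(p + (p + r) - 1) div 2 = p + (r - 1) div 2" by simp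
qed

lemma f'_facts: "f' \<noteq> 0" "homogeneous3 (p + r - 1) f'" "vanishes_on_param p r f'"
  using f' by (simp_all add: gate_form_def)

lemma curve_pullback:
  "curve3 f' (u * w) (v\<^sup>2 - u\<^sup>2) (v * w) =
    ((v + u) ^ (r div 2) * (v - u) ^ ((r - 1) div 2)) * curve3 f u v w"
  unfolding curve3_heron_pullback[symmetric] pullback by (simp add: subst3_simps mult.assoc)

lemma nonzero: "f \<noteq> 0"
  using heron_pullback_nonzero[OF f'_facts(2,1)] pullback by auto

lemma homogeneous: "homogeneous3 (p + (p + r) - 1) f"
proof -
  let ?L = "(var_b + var_a) ^ (r div 2) * (var_b - var_a) ^ ((r - 1) div 2)"
  have *: "homogeneous3 (r div 2 * 1 + (r - 1) div 2 * 1) ?L"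
    by (intro homogeneous3_mult homogeneous3_power homogeneous3_add homogeneous3_diff homogeneous3_var)
  have "r div 2 * 1 + (r - 1) div 2 * 1 + (p + (p + r) - 1) = 2 * (p + r - 1)"
    using pos halves by linarith
  hence "homogeneous3 (r div 2 * 1 + (r - 1) div 2 * 1 + (p + (p + r) - 1)) (?L * f)"
    using homogeneous3_heron_pullback[OF f'_facts(2)] unfolding pullback by (simp only:)
  moreover have "?L \<noteq> 0"
    using heron_pullback_nonzero[OF f'_facts(2,1)] unfolding pullback by simp
  ultimately show ?thesis
    by (rule homogeneous3_cancel[OF *])
qed

lemma vanishes: "vanishes_on_param p (p + r) f"
proof -
  have "vanishes_on_param p (p + r) (heron_pullback f')"
    using f'_facts pos by (intro vanishes_on_param_heron_pullback)
  moreover have "\<not> vanishes_on_param p (p + r)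
      ((var_b + var_a) ^ (r div 2) * (var_b - var_a) ^ ((r - 1) div 2))"
    using pos by (intro not_vanishes_on_param_mult not_vanishes_on_param_power
        not_vanishes_on_param_linear) auto
  ultimately show ?thesis
    unfolding pullback by (rule vanishes_on_param_cancel)
qed

text \<open>Off the lines b = \<plusminus>a the split factors are units along the germ, so the order
  at H(x, y, z) passes unchanged to (x, y, z).\<close>

lemma vanishes_off_exceptional:
  assumes "y + x \<noteq> 0" "y - x \<noteq> 0" "vanishes_to_order m f' (x * z) (y\<^sup>2 - x\<^sup>2) (y * z)"
  shows "vanishes_to_order m f x y z"
  unfolding vanishes_to_order_def
proof (intro allI impI)
  fix u v w :: "complex poly"
  assume *: "poly u 0 = x" "poly v 0 = y" "poly w 0 = z"
  have "[:0, 1:] ^ m dvd curve3 f' (u * w) (v\<^sup>2 - u\<^sup>2) (v * w)"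
    using assms(3) * by (intro vanishes_to_orderD) simp
  hence "[:0, 1:] ^ (m - 0) dvd curve3 f u v w"
    unfolding curve_pullback by (rule X_power_dvd_cancel[where k = 0]) (use assms * in auto)
  thus "[:0, 1:] ^ m dvd curve3 f u v w" by simp
qed

text \<open>At the points where \<open>H\<close> is undefined, all three components of \<open>H\<close> vanish, so \<open>f' \<circ> H\<close> vanishes to
  order at least the degree of \<open>f'\<close>.\<close>

lemma vanishes_on_indeterminacy:
  assumes "u * w = [:0, 1:] * u'" "v\<^sup>2 - u\<^sup>2 = [:0, 1:] * v'" "v * w = [:0, 1:] * w'"
    and "v + u = [:0, 1:] ^ i * k" "v - u = [:0, 1:] ^ j * l" "poly k 0 \<noteq> 0" "poly l 0 \<noteq> 0"
  shows "[:0, 1:] ^ (p + r - 1 - (i * (r div 2) + j * ((r - 1) div 2))) dvd curve3 f u v w"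
proof (rule X_power_dvd_cancel)
  show "[:0, 1:] ^ (p + r - 1) dvd
      ((v + u) ^ (r div 2) * (v - u) ^ ((r - 1) div 2)) * curve3 f u v w"
    unfolding curve_pullback[symmetric] assms(1-3)
    by (subst homogeneous3_subst3[OF f'_facts(2)]) simp_all
  show "(v + u) ^ (r div 2) * (v - u) ^ ((r - 1) div 2) =
      [:0, 1:] ^ (i * (r div 2) + j * ((r - 1) div 2)) * (k ^ (r div 2) * l ^ ((r - 1) div 2))"
    unfolding assms(4,5) power_mult_distrib power_add power_mult by (simp only: mult_ac)
  show "poly (k ^ (r div 2) * l ^ ((r - 1) div 2)) 0 \<noteq> 0"
    using assms(6,7) by simp
qed

lemma vanishes_G_plus: "vanishes_to_order ((p + (p + r)) div 2) f 1 1 0"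
proof (rule vanishes_to_order_lines)
  show "var_b - const3 1 * var_a \<noteq> 0"
    by (rule linear_form_nonzero)
  fix a b c assume "eval3 (var_b - const3 1 * var_a) a b c \<noteq> 0"
  hence "b - a \<noteq> 0" by (simp add: subst3_simps)
  \<comment> \<open>Along these lines b - a vanishes to order one and b + a not at all, so only the
    factor b - a absorbs part of the order.\<close>
  have "p + r - 1 - (0 * (r div 2) + 1 * ((r - 1) div 2)) = (p + (p + r)) div 2"
    using pos halves by linarith
  thus "[:0, 1:] ^ ((p + (p + r)) div 2) dvd curve3 f [:1, a:] [:1, b:] [:0, c:]"
    using vanishes_on_indeterminacy[of "[:1, a:]" "[:0, c:]" "[:c, a * c:]" "[:1, b:]"
        "[:b - a:] * [:2, a + b:]" "[:c, b * c:]" 0 "[:2, b + a:]" 1 "[:b - a:]"] \<open>b - a \<noteq> 0\<close>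
    by (simp add: power2_eq_square algebra_simps)
qed

lemma vanishes_G_minus: "vanishes_to_order ((p + (p + r) - 1) div 2) f 1 (- 1) 0"
proof (rule vanishes_to_order_lines)
  show "var_b - const3 (- 1) * var_a \<noteq> 0"
    by (rule linear_form_nonzero)
  fix a b c assume "eval3 (var_b - const3 (- 1) * var_a) a b c \<noteq> 0"
  hence "b + a \<noteq> 0" by (simp add: subst3_simps)
  have "p + r - 1 - (1 * (r div 2) + 0 * ((r - 1) div 2)) = (p + (p + r) - 1) div 2"
    using pos halves by linarith
  thus "[:0, 1:] ^ ((p + (p + r) - 1) div 2) dvd curve3 f [:1, a:] [:- 1, b:] [:0, c:]"
    using vanishes_on_indeterminacy[of "[:1, a:]" "[:0, c:]" "[:c, a * c:]" "[:- 1, b:]"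
        "[:b + a:] * [:- 2, b - a:]" "[:- c, b * c:]" 1 "[:b + a:]" 0 "[:- 2, b - a:]"] \<open>b + a \<noteq> 0\<close>
    by (simp add: power2_eq_square algebra_simps)
qed

lemma vanishes_G_zero: "vanishes_to_order p f 0 0 1"
proof (rule vanishes_to_order_lines)
  show "(var_b - const3 1 * var_a) * (var_b - const3 (- 1) * var_a) \<noteq> 0"
    by (intro no_zero_divisors linear_form_nonzero)
  fix a b c assume "eval3 ((var_b - const3 1 * var_a) * (var_b - const3 (- 1) * var_a)) a b c \<noteq> 0"
  hence "b - a \<noteq> 0" "b + a \<noteq> 0" by (simp_all add: subst3_simps)
  \<comment> \<open>Both linear factors vanish to order one here and absorb r - 1 in total.\<close>
  have "p + r - 1 - (1 * (r div 2) + 1 * ((r - 1) div 2)) = p"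
    using pos halves by linarith
  thus "[:0, 1:] ^ p dvd curve3 f [:0, a:] [:0, b:] [:1, c:]"
    using vanishes_on_indeterminacy[of "[:0, a:]" "[:1, c:]" "[:a, a * c:]" "[:0, b:]"
        "[:0, b\<^sup>2 - a\<^sup>2:]" "[:b, b * c:]" 1 "[:b + a:]" 1 "[:b - a:]"] \<open>b - a \<noteq> 0\<close> \<open>b + a \<noteq> 0\<close>
    by (simp add: power2_eq_square algebra_simps)
qed

lemma gate_form: "gate_form p (p + r) f"
proof -
  \<comment> \<open>H maps the representative (1, 0, -1) of F_- to (-1, -1, 0), the negative of the
    one chosen for G_+. The points E_\<plusminus> are fixed and F_+ goes to (1, -1, 0)
    exactly.\<close>
  have "vanishes_to_order ((p + r) div 2) f' ((- 1) * 1) ((- 1) * 1) ((- 1) * 0)"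
    using f' by (intro vanishes_to_order_scale[OF f'_facts(2)]) (auto simp: gate_form_def)
  hence F_minus: "vanishes_to_order ((p + r) div 2) f 1 0 (- 1)"
    by (intro vanishes_off_exceptional) simp_all
  have E: "vanishes_to_order ((p - 1) div 2) f 0 1 1" "vanishes_to_order (p div 2) f 0 1 (- 1)"
    and F_plus: "vanishes_to_order ((p + r - 1) div 2) f 1 0 1"
    using f' by (intro vanishes_off_exceptional; simp add: gate_form_def)+
  show ?thesis
    unfolding gate_form_def
    using nonzero homogeneous vanishes E F_plus F_minus vanishes_G_plus vanishes_G_minus
    by (intro conjI)
qed

end

lemma heron_step_exists:
  assumes "p > 0" "r > 0" "gate_form p r f'"
  obtains f where "heron_step p r f' f"
proof -
  have f': "homogeneous3 (p + r - 1) f'" "heron_pullback f' \<noteq> 0"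
    "vanishes_to_order ((r - 1) div 2) f' 1 0 1" "vanishes_to_order (r div 2) f' 1 0 (- 1)"
    using assms heron_pullback_nonzero by (auto simp: gate_form_def)
  have minus: "const3 (- 1) = - 1"
    using is_hom_diff[OF is_hom_const3, of 0 1] by (simp add: is_hom_zero[OF is_hom_const3])
  have "(var_b - const3 1 * var_a) ^ ((r - 1) div 2) dvd heron_pullback f'"
    "(var_b - const3 (- 1) * var_a) ^ (r div 2) dvd heron_pullback f'"
    using f' by (intro linear_form_power_dvd_heron_pullback; simp)+
  hence "(var_b + var_a) ^ (r div 2) * (var_b - var_a) ^ ((r - 1) div 2) dvd heron_pullback f'"
    by (intro linear_form_powers_dvd) (simp_all add: minus)
  then obtain f where
    "heron_pullback f' = (var_b + var_a) ^ (r div 2) * (var_b - var_a) ^ ((r - 1) div 2) * f" ..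
  hence "heron_step p r f' f"
    using assms by unfold_locales
  thus ?thesis by (rule that)
qed

lemma gate_form_swap:
  assumes "gate_form p q f" "p > 0" "q > 0"
  shows "\<exists>g. gate_form q p g"
proof
  define g where "g = subst3 const3 f var_b var_a var_c"
  have curve: "curve3 g u v w = curve3 f v u w" for u v w
    by (simp add: g_def subst3_subst3 subst3_simps)
  have f: "f \<noteq> 0" "homogeneous3 (p + q - 1) f"
    using assms by (simp_all add: gate_form_def)
  obtain x y z where "eval3 f x y z \<noteq> 0"
    using eval3_nonzeroE[OF f(1)] .
  moreover have "eval3 g y x z = eval3 f x y z"
    by (simp add: g_def subst3_subst3 subst3_simps)
  ultimately have "g \<noteq> 0"
    by (auto simp: subst3_hom_simps)
  have "homogeneous3 (1 * (p + q - 1)) g"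
    unfolding g_def by (intro homogeneous3_subst3_forms f homogeneous3_var)
  have swap: "vanishes_to_order m g y x z" if "vanishes_to_order m f x y z" for m x y z
    using that by (auto simp: vanishes_to_order_def curve)
  \<comment> \<open>Exchanging a and b swaps E with F and turns (1, -1, 0) into its negative, hence
    the rescaling by -1.\<close>
  have "vanishes_to_order ((p + q - 1) div 2) f ((- 1) * 1) ((- 1) * (- 1)) ((- 1) * 0)"
    using assms by (intro vanishes_to_order_scale[OF f(2)]) (auto simp: gate_form_def)
  thus "gate_form q p g"
    using assms \<open>g \<noteq> 0\<close> \<open>homogeneous3 (1 * (p + q - 1)) g\<close>
    by (auto simp: gate_form_def vanishes_on_param_iff curve add.commute intro!: swap)
qed

text \<open>\<Gamma> for (1, 1) is [1 : 1 : 2t], the line a = b; the only bound with a positive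
  value is order one at G_+.\<close>

lemma gate_form_1_1: "gate_form 1 1 (var_a - var_b)"
proof -
  have "- (var_b - const3 1 * var_a) \<noteq> 0"
    using linear_form_nonzero[of 1] by simp
  moreover have "vanishes_to_order 1 (var_a - var_b) 1 1 0"
    unfolding vanishes_to_order_def
  proof (intro allI impI)
    fix u v w :: "complex poly" assume "poly u 0 = 1" "poly v 0 = 1"
    hence "[:- 0, 1:] dvd u - v"
      unfolding poly_eq_0_iff_dvd[symmetric] by simp
    thus "[:0, 1:] ^ 1 dvd curve3 (var_a - var_b) u v w"
      by (simp add: subst3_simps)
  qed
  ultimately show ?thesis
    using homogeneous3_diff[OF homogeneous3_var(1,2)]
    by (auto simp: gate_form_def vanishes_on_param_iff subst3_simps)
qed

lemma gate_form_exists: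
  assumes "p > 0" "q > 0" "coprime p q"
  shows "\<exists>f. gate_form p q f"
  using assms
proof (induction "p + q" arbitrary: p q rule: less_induct)
  case less
  have step: "\<exists>f. gate_form m n f" if mn: "m < n" "m + n = p + q" "m > 0" "coprime m n" for m n
  proof -
    have "coprime m (n - m)"
      using mn gcd_diff1_nat[of m n] by (simp add: coprime_iff_gcd_eq_1 gcd.commute[of m])
    hence "\<exists>f'. gate_form m (n - m) f'"
      using mn by (intro less.hyps) auto
    then obtain f' where "gate_form m (n - m) f'" ..
    then obtain f where "heron_step m (n - m) f' f"
      using heron_step_exists[of m "n - m" f'] mn by auto
    from heron_step.gate_form[OF this] show ?thesis
      using mn(1) by auto
  qed
  consider "p = q" | "p < q" | "q < p" by linarith
  thus ?case
  proof cases
    case 1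
    hence "p = 1" "q = 1" using less.prems by auto
    thus ?thesis using gate_form_1_1 by blast
  next
    case 2
    thus ?thesis using step less.prems by simp
  next
    case 3
    then obtain f where "gate_form q p f"
      using step[of q p] less.prems by (auto simp: coprime_commute)
    thus ?thesis using gate_form_swap less.prems by blast
  qed
qed

subsection \<open>Pencils of lines\<close>

text \<open>Subtract the multiple of \<beta> that creates a root at a point where \<beta> is
  nonzero. A nonzero difference \<gamma> has \<gamma> \<beta>' of order at least that of \<gamma>
  there, while \<gamma>' \<beta> has order one less.\<close>

lemma wronskian_eq_0D:
  fixes \<alpha> \<beta> :: "complex poly"
  assumes "\<alpha> * pderiv \<beta> = pderiv \<alpha> * \<beta>" "\<beta> \<noteq> 0"
  obtains \<kappa> where "\<alpha> = smult \<kappa> \<beta>"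
proof -
  obtain t where t: "poly \<beta> t \<noteq> 0"
    using assms(2) poly_all_0_iff_0 by blast
  define \<kappa> where "\<kappa> = poly \<alpha> t / poly \<beta> t"
  define \<gamma> where "\<gamma> = \<alpha> - smult \<kappa> \<beta>"
  have root: "poly \<gamma> t = 0"
    using t by (simp add: \<gamma>_def \<kappa>_def)
  have W: "\<gamma> * pderiv \<beta> = pderiv \<gamma> * \<beta>"
    using assms(1) by (simp add: \<gamma>_def pderiv_diff pderiv_smult algebra_simps)
  have "\<gamma> = 0"
  proof (rule ccontr)
    assume nz: "\<gamma> \<noteq> 0"
    from order_pderiv[OF this root] have ord: "order t \<gamma> = Suc (order t (pderiv \<gamma>))" .
    have "pderiv \<gamma> \<noteq> 0"
    proof
      assume "pderiv \<gamma> = 0"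
      then obtain c where "\<gamma> = [:c:]"
        by (auto simp: pderiv_eq_0_iff elim: degree_eq_zeroE)
      thus False using nz root by simp
    qed
    hence "pderiv \<gamma> * \<beta> \<noteq> 0"
      using assms(2) by simp
    hence "order t \<gamma> + order t (pderiv \<beta>) = order t (pderiv \<gamma>) + order t \<beta>"
      using W by (metis order_mult)
    thus False
      using ord t by (simp add: order_root)
  qed
  thus ?thesis
    using that[of \<kappa>] by (simp add: \<gamma>_def)
qed

lemma rsquarefree_card_roots:
  fixes p :: "complex poly"
  assumes "rsquarefree p"
  shows "card {z. poly p z = 0} = degree p"
proof -
  have "p \<noteq> 0" using assms by (auto simp: rsquarefree_def)
  have "p = smult (lead_coeff p) (\<Prod>z | poly p z = 0. [:- z, 1:])"
    using complex_poly_decompose_rsquarefree[OF assms] by simp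
  hence "degree p = degree (\<Prod>z | poly p z = 0. [:- z, 1:])"
    using \<open>p \<noteq> 0\<close> by (metis degree_smult_eq leading_coeff_0_iff)
  also have "\<dots> = card {z. poly p z = 0}"
    by (subst degree_prod_eq_sum_degree) auto
  finally show ?thesis ..
qed

text \<open>For generic \<open>\<mu>\<close> the roots of \<open>\<alpha> - \<mu> \<beta>\<close> are simple: a double root outside the base points is a
  root of the Wronskian, which determines \<open>\<mu>\<close>.\<close>

lemma generic_pencil_member:
  fixes \<alpha> \<beta> :: "complex poly"
  assumes nz: "\<alpha> \<noteq> 0 \<or> \<beta> \<noteq> 0"
    and simple: "\<And>t. poly \<alpha> t = 0 \<Longrightarrow> poly \<beta> t = 0 \<Longrightarrow>
      poly (pderiv \<alpha>) t \<noteq> 0 \<or> poly (pderiv \<beta>) t \<noteq> 0"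
    and S: "finite S"
  obtains \<Lambda> where "finite \<Lambda>" "\<And>\<mu>. \<mu> \<notin> \<Lambda> \<Longrightarrow>
    \<exists>R. finite R \<and> R \<inter> S = {} \<and> (\<forall>t\<in>R. poly \<alpha> t = \<mu> * poly \<beta> t \<and> poly \<beta> t \<noteq> 0) \<and>
      card R + card {t. poly \<alpha> t = 0 \<and> poly \<beta> t = 0} = max (degree \<alpha>) (degree \<beta>)"
proof -
  define Z where "Z = {t. poly \<alpha> t = 0 \<and> poly \<beta> t = 0}"
  define n where "n = max (degree \<alpha>) (degree \<beta>)"
  have "finite Z"
    using nz finite_subset[of Z "{t. poly \<alpha> t = 0}"] finite_subset[of Z "{t. poly \<beta> t = 0}"]
    by (auto simp: Z_def poly_roots_finite)
  have "\<exists>\<Lambda>. finite \<Lambda> \<and> (\<forall>\<mu>. \<mu> \<notin> \<Lambda> \<longrightarrow> (\<forall>t. t \<notin> Z \<longrightarrow> poly \<alpha> t = \<mu> * poly \<beta> t \<longrightarrow>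
      poly (pderiv \<alpha>) t \<noteq> \<mu> * poly (pderiv \<beta>) t))"
  proof -
    define W where "W = \<alpha> * pderiv \<beta> - pderiv \<alpha> * \<beta>"
    consider "W \<noteq> 0" | "W = 0" "\<beta> \<noteq> 0" | "\<beta> = 0" by blast
    thus ?thesis
    proof cases
      case 1
      show ?thesis
      proof (intro exI[of _ "(\<lambda>t. poly \<alpha> t / poly \<beta> t) ` {t. poly W t = 0}"] conjI allI impI notI)
        show "finite ((\<lambda>t. poly \<alpha> t / poly \<beta> t) ` {t. poly W t = 0})"
          using 1 by (simp add: poly_roots_finite)
        fix \<mu> t
        assume *: "\<mu> \<notin> (\<lambda>t. poly \<alpha> t / poly \<beta> t) ` {t. poly W t = 0}" "t \<notin> Z"
          "poly \<alpha> t = \<mu> * poly \<beta> t" "poly (pderiv \<alpha>) t = \<mu> * poly (pderiv \<beta>) t"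
        hence "poly \<beta> t \<noteq> 0" "poly W t = 0"
          by (auto simp: Z_def W_def)
        thus False using * by (auto simp: image_iff)
      qed
    next
      case 2
      then obtain \<kappa> where \<kappa>: "\<alpha> = smult \<kappa> \<beta>"
        using wronskian_eq_0D[of \<alpha> \<beta>] by (auto simp: W_def)
      show ?thesis
        by (intro exI[of _ "{\<kappa>}"]) (auto simp: \<kappa> Z_def)
    next
      case 3
      thus ?thesis by (intro exI[of _ "{}"]) (auto simp: Z_def)
    qed
  qed
  then obtain \<Lambda>1 where \<Lambda>1: "finite \<Lambda>1" "\<And>\<mu> t. \<mu> \<notin> \<Lambda>1 \<Longrightarrow> t \<notin> Z \<Longrightarrow> poly \<alpha> t = \<mu> * poly \<beta> t \<Longrightarrow>
      poly (pderiv \<alpha>) t \<noteq> \<mu> * poly (pderiv \<beta>) t"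
    by blast
  \<comment> \<open>Besides the values from the Wronskian, this excludes the slope at which the
    degree drops, slopes giving a double root at a base point, and slopes of lines through points
    with parameter in \<open>S\<close>. A zero denominator merely excludes \<mu> = 0 as
    well.\<close>
  define \<Lambda> where "\<Lambda> = \<Lambda>1 \<union> {coeff \<alpha> n / coeff \<beta> n}
    \<union> (\<lambda>t. poly (pderiv \<alpha>) t / poly (pderiv \<beta>) t) ` Z \<union> (\<lambda>t. poly \<alpha> t / poly \<beta> t) ` S"
  show ?thesis
  proof (rule that[of \<Lambda>])
    show "finite \<Lambda>"
      using \<Lambda>1(1) \<open>finite Z\<close> S by (simp add: \<Lambda>_def)
    fix \<mu> assume \<mu>: "\<mu> \<notin> \<Lambda>"
    define \<pi> where "\<pi> = \<alpha> - smult \<mu> \<beta>"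
    have "coeff \<alpha> n \<noteq> 0 \<or> coeff \<beta> n \<noteq> 0"
      using nz by (cases "\<alpha> = 0"; cases "\<beta> = 0") (auto simp: n_def max_def)
    hence "coeff \<pi> n \<noteq> 0"
      using \<mu> by (cases "coeff \<beta> n = 0") (auto simp: \<pi>_def \<Lambda>_def)
    moreover have "degree \<pi> \<le> n"
      unfolding \<pi>_def by (intro degree_diff_le) (auto simp: n_def intro: order_trans[OF degree_smult_le])
    ultimately have deg: "degree \<pi> = n" "\<pi> \<noteq> 0"
      using le_degree[of \<pi> n] by auto
    have "rsquarefree \<pi>"
      unfolding rsquarefree_roots
    proof (intro allI notI, elim conjE)
      fix t assume t: "poly \<pi> t = 0" "poly (pderiv \<pi>) t = 0"
      have eq: "poly \<alpha> t = \<mu> * poly \<beta> t" "poly (pderiv \<alpha>) t = \<mu> * poly (pderiv \<beta>) t"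
        using t by (auto simp: \<pi>_def pderiv_diff pderiv_smult)
      show False
      proof (cases "t \<in> Z")
        case True
        hence "poly (pderiv \<beta>) t \<noteq> 0"
          using simple[of t] eq by (auto simp: Z_def)
        thus False using True \<mu> eq by (auto simp: \<Lambda>_def image_iff)
      next
        case False
        thus False using \<Lambda>1(2)[of \<mu> t] \<mu> eq by (simp add: \<Lambda>_def)
      qed
    qed
    hence card: "card {t. poly \<pi> t = 0} = n"
      using deg by (simp add: rsquarefree_card_roots)
    define R where "R = {t. poly \<pi> t = 0} - Z"
    have "Z \<subseteq> {t. poly \<pi> t = 0}"
      by (auto simp: Z_def \<pi>_def)
    hence "card R + card Z = n"
      using card \<open>finite Z\<close> deg(2) card_mono[of "{t. poly \<pi> t = 0}" Z]
      by (simp add: R_def card_Diff_subset poly_roots_finite)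
    moreover have R: "poly \<alpha> t = \<mu> * poly \<beta> t \<and> poly \<beta> t \<noteq> 0" if "t \<in> R" for t
      using that by (auto simp: R_def \<pi>_def Z_def)
    moreover have "R \<inter> S = {}"
    proof (intro equals0I, elim IntE)
      fix t assume "t \<in> R" "t \<in> S"
      with R[OF this(1)] \<mu> show False by (auto simp: \<Lambda>_def image_iff)
    qed
    moreover have "finite R"
      using deg(2) by (simp add: R_def poly_roots_finite)
    ultimately show "\<exists>R. finite R \<and> R \<inter> S = {} \<and> (\<forall>t\<in>R. poly \<alpha> t = \<mu> * poly \<beta> t \<and> poly \<beta> t \<noteq> 0) \<and>
      card R + card {t. poly \<alpha> t = 0 \<and> poly \<beta> t = 0} = max (degree \<alpha>) (degree \<beta>)"
      unfolding Z_def n_def by blast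
  qed
qed

subsection \<open>The lowest degree of a bivariate polynomial\<close>

text \<open>The restriction of \<open>g\<close> to the line \<open>X = \<mu> s, Y = s\<close>.\<close>

definition line2 :: "complex \<Rightarrow> complex poly poly \<Rightarrow> complex poly" where
  "line2 \<mu> g = poly (map_poly (\<lambda>h. poly (map_poly (\<lambda>k. [:k:]) h) [:0, \<mu>:]) g) [:0, 1:]"

lemma is_hom_line2: "is_hom (line2 \<mu>)"
  unfolding line2_def[abs_def] by (intro is_hom_eval is_hom_pconst)

lemma line2_simps:
  "line2 \<mu> (const2 k) = [:k:]" "line2 \<mu> var_X = [:0, \<mu>:]" "line2 \<mu> var_Y = [:0, 1:]"
  by (simp_all add: line2_def const2_def var_X_def var_Y_def map_poly_pCons one_pCons)

lemma line2_subst3: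
  "line2 \<mu> (subst3 const2 f u v w) = curve3 f (line2 \<mu> u) (line2 \<mu> v) (line2 \<mu> w)"
  by (subst hom_subst3[OF is_hom_line2 is_hom_const2]) (simp add: line2_simps)

lemma coeff_line2:
  "coeff (line2 \<mu> g) k = (\<Sum>j\<le>k. \<mu> ^ (k - j) * coeff (coeff g j) (k - j))"
proof (induction g arbitrary: k)
  case 0
  show ?case by (simp add: is_hom_zero[OF is_hom_line2])
next
  case (pCons h g)
  have hom: "is_hom (\<lambda>h. poly (map_poly (\<lambda>k. [:k :: complex:]) h) [:0, \<mu>:])"
    by (intro is_hom_eval is_hom_pconst)
  have eq: "line2 \<mu> (pCons h g) = poly (map_poly (\<lambda>k. [:k:]) h) [:0, \<mu>:] + [:0, 1:] * line2 \<mu> g"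
    unfolding line2_def by (rule eval_map_poly_pCons[OF hom])
  show ?case
  proof (cases k)
    case 0
    thus ?thesis
      by (simp add: eq coeff_eval_map_poly_linear[OF is_hom_id])
  next
    case (Suc k')
    thus ?thesis
      by (simp add: eq coeff_eval_map_poly_linear[OF is_hom_id] pCons.IH sum.atMost_Suc_shift
          del: sum.atMost_Suc)
  qed
qed

text \<open>The degree-k part of \<open>g\<close> at X = \<mu>, Y = 1, as a polynomial in \<mu>. All
  but finitely many lines through the origin therefore see the lowest degree of \<open>g\<close>
  exactly.\<close>

definition line2_coeff :: "complex poly poly \<Rightarrow> nat \<Rightarrow> complex poly" where
  "line2_coeff g k = (\<Sum>j\<le>k. monom (coeff (coeff g j) (k - j)) (k - j))"

lemma poly_line2_coeff: "poly (line2_coeff g k) \<mu> = coeff (line2 \<mu> g) k"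
  by (simp add: line2_coeff_def coeff_line2 poly_sum poly_monom mult.commute)

lemma line2_coeff_eq_0_iff:
  "line2_coeff g k = 0 \<longleftrightarrow> (\<forall>i j. i + j = k \<longrightarrow> coeff (coeff g j) i = 0)"
proof
  assume *: "line2_coeff g k = 0"
  show "\<forall>i j. i + j = k \<longrightarrow> coeff (coeff g j) i = 0"
  proof (intro allI impI)
    fix i j assume k: "i + j = k"
    have "coeff (line2_coeff g k) i = (\<Sum>j'\<le>k. if j' = j then coeff (coeff g j') (k - j') else 0)"
      unfolding line2_coeff_def coeff_sum coeff_monom using k by (intro sum.cong) auto
    also have "\<dots> = coeff (coeff g j) i"
      using k by (subst sum.delta) auto
    finally show "coeff (coeff g j) i = 0"
      using * by simp
  qed
qed (simp add: line2_coeff_def)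

lemma lowest_degree_properties:
  assumes "g \<noteq> 0"
  shows "line2_coeff g (lowest_degree g) \<noteq> 0"
    and "k < lowest_degree g \<Longrightarrow> line2_coeff g k = 0"
proof -
  have ld: "lowest_degree g = (LEAST d. line2_coeff g d \<noteq> 0)"
    unfolding lowest_degree_def line2_coeff_eq_0_iff by (intro arg_cong[where f = Least] ext) blast
  obtain i j where "coeff (coeff g j) i \<noteq> 0"
    using assms by (metis leading_coeff_0_iff)
  hence "line2_coeff g (i + j) \<noteq> 0"
    by (auto simp: line2_coeff_eq_0_iff)
  thus "line2_coeff g (lowest_degree g) \<noteq> 0"
    unfolding ld by (rule LeastI)
  show "line2_coeff g k = 0" if "k < lowest_degree g"
    using not_less_Least that unfolding ld by blast
qed

lemma lowest_degree_ge:
  assumes "g \<noteq> 0" "\<And>\<mu>. [:0, 1:] ^ m dvd line2 \<mu> g"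
  shows "m \<le> lowest_degree g"
proof (rule ccontr)
  assume "\<not> m \<le> lowest_degree g"
  hence "poly (line2_coeff g (lowest_degree g)) \<mu> = 0" for \<mu>
    using assms(2)[of \<mu>] by (simp add: poly_line2_coeff X_power_dvd_iff)
  hence "line2_coeff g (lowest_degree g) = 0"
    by (intro complex_poly_eqI[of "{}"]) auto
  thus False
    using lowest_degree_properties(1)[OF assms(1)] by simp
qed

subsection \<open>Bounding the multiplicity by counting intersections with a generic line\<close>

text \<open>Here \<alpha>/C and \<beta>/C are affine coordinates centred at the point. A generic
  line X = \<mu> Y meets the curve at max(deg \<alpha>, deg \<beta>) parameters, all simple; those
  not at the origin give distinct nonzero roots s = \<beta>/C of \<open>g\<close> on the line. With
  the root of order \<open>lowest_degree g\<close> at s = 0, they number at most e.\<close>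

lemma lowest_degree_bound:
  assumes "g \<noteq> 0" and deg: "\<And>\<mu>. degree (line2 \<mu> g) \<le> e"
    and zero: "\<And>\<mu> t. poly C t \<noteq> 0 \<Longrightarrow> poly \<alpha> t = \<mu> * poly \<beta> t \<Longrightarrow>
      poly (line2 \<mu> g) (poly \<beta> t / poly C t) = 0"
    and nz: "\<alpha> \<noteq> 0 \<or> \<beta> \<noteq> 0"
    and simple: "\<And>t. poly \<alpha> t = 0 \<Longrightarrow> poly \<beta> t = 0 \<Longrightarrow>
      poly (pderiv \<alpha>) t \<noteq> 0 \<or> poly (pderiv \<beta>) t \<noteq> 0"
    and S: "finite S" "\<And>t. t \<notin> S \<Longrightarrow> poly C t \<noteq> 0"
    and inj: "\<And>t t'. t \<notin> S \<Longrightarrow> t' \<notin> S \<Longrightarrow> poly \<alpha> t / poly C t = poly \<alpha> t' / poly C t' \<Longrightarrow>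
      poly \<beta> t / poly C t = poly \<beta> t' / poly C t' \<Longrightarrow> t = t'"
  shows "lowest_degree g + max (degree \<alpha>) (degree \<beta>) \<le>
    e + card {t. poly \<alpha> t = 0 \<and> poly \<beta> t = 0}"
proof -
  define k where "k = lowest_degree g"
  obtain \<Lambda> where \<Lambda>: "finite \<Lambda>" "\<And>\<mu>. \<mu> \<notin> \<Lambda> \<Longrightarrow>
    \<exists>R. finite R \<and> R \<inter> S = {} \<and> (\<forall>t\<in>R. poly \<alpha> t = \<mu> * poly \<beta> t \<and> poly \<beta> t \<noteq> 0) \<and>
      card R + card {t. poly \<alpha> t = 0 \<and> poly \<beta> t = 0} = max (degree \<alpha>) (degree \<beta>)"
    using generic_pencil_member[OF nz simple S(1)] by blast
  have "finite (\<Lambda> \<union> {\<mu>. poly (line2_coeff g k) \<mu> = 0})"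
    using \<Lambda>(1) lowest_degree_properties(1)[OF assms(1)] by (simp add: k_def poly_roots_finite)
  then obtain \<mu> where \<mu>: "\<mu> \<notin> \<Lambda>" "poly (line2_coeff g k) \<mu> \<noteq> 0"
    using ex_new_if_finite[OF infinite_UNIV_char_0] by blast
  from \<Lambda>(2)[OF \<mu>(1)] obtain R where R: "finite R" "R \<inter> S = {}"
    "\<And>t. t \<in> R \<Longrightarrow> poly \<alpha> t = \<mu> * poly \<beta> t" "\<And>t. t \<in> R \<Longrightarrow> poly \<beta> t \<noteq> 0"
    "card R + card {t. poly \<alpha> t = 0 \<and> poly \<beta> t = 0} = max (degree \<alpha>) (degree \<beta>)"
    by blast
  define P where "P = line2 \<mu> g"
  have "[:0, 1:] ^ k dvd P"
    using lowest_degree_properties(2)[OF assms(1)]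
    by (auto simp: X_power_dvd_iff P_def k_def simp flip: poly_line2_coeff)
  then obtain Q where Q: "P = [:0, 1:] ^ k * Q" ..
  have "P \<noteq> 0"
    using \<mu>(2) by (auto simp: poly_line2_coeff P_def)
  hence "Q \<noteq> 0" using Q by auto
  hence degQ: "k + degree Q = degree P"
    by (simp add: Q degree_mult_eq degree_power_eq)
  define s where "s t = poly \<beta> t / poly C t" for t
  have "inj_on s R"
  proof (rule inj_onI)
    fix t t' assume *: "t \<in> R" "t' \<in> R" "s t = s t'"
    hence "\<mu> * s t = \<mu> * s t'" by simp
    hence "poly \<alpha> t / poly C t = poly \<alpha> t' / poly C t'"
      using R(3) * by (simp add: s_def)
    thus "t = t'"
      using inj[of t t'] * R(2) by (auto simp: s_def)
  qed
  have "s ` R \<subseteq> {x. poly Q x = 0}"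
  proof (intro image_subsetI)
    fix t assume t: "t \<in> R"
    hence "poly C t \<noteq> 0" using S(2) R(2) by blast
    hence "poly P (s t) = 0" "s t \<noteq> 0"
      using zero[of t \<mu>] R(3,4)[OF t] by (simp_all add: P_def s_def)
    thus "s t \<in> {x. poly Q x = 0}" by (simp add: Q)
  qed
  hence "card (s ` R) \<le> card {x. poly Q x = 0}"
    using \<open>Q \<noteq> 0\<close> by (intro card_mono poly_roots_finite)
  also have "\<dots> \<le> degree Q"
    using \<open>Q \<noteq> 0\<close> by (rule card_poly_roots_bound)
  finally have "card R \<le> degree Q"
    using \<open>inj_on s R\<close> by (simp add: card_image)
  thus ?thesis
    using degQ deg[of \<mu>] R(5) by (simp add: P_def k_def)
qed

lemma degree_curve3_le:
  assumes "homogeneous3 e f" "degree u \<le> 1" "degree v \<le> 1" "degree w \<le> 1"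
  shows "degree (curve3 f u v w) \<le> e"
  unfolding subst3_altdef[OF is_hom_pconst]
proof (intro degree_sum_le finite_atMost)
  fix i j k
  show "degree ([:coeff (coeff (coeff f k) j) i:] * (u ^ i * v ^ j * w ^ k)) \<le> e"
  proof (cases "coeff (coeff (coeff f k) j) i = 0")
    case False
    hence e: "i + j + k = e"
      using assms(1) by (auto simp: homogeneous3_def)
    have pow: "degree (r ^ n) \<le> n" if "degree r \<le> 1" for r :: "complex poly" and n
      using order_trans[OF degree_power_le mult_le_mono1[OF that]] by simp
    have "degree (u ^ i * v ^ j * w ^ k) \<le> i + j + k"
      by (intro order_trans[OF degree_mult_le] add_mono pow assms)
    thus ?thesis
      using e by (auto intro: order_trans[OF degree_mult_le])
  qed simp
qed

lemma affine_expansion_nonzero: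
  assumes "homogeneous3 e f" "f \<noteq> 0"
  shows "subst3 const2 f (const2 x + var_X) (const2 y + var_Y) 1 \<noteq> 0"
proof
  assume *: "subst3 const2 f (const2 x + var_X) (const2 y + var_Y) 1 = 0"
  have "eval3 var_c 0 0 1 \<noteq> 0"
    by (simp add: subst3_simps)
  hence "f * var_c \<noteq> 0"
    using assms(2) by (metis is_hom_zero[OF is_hom_subst3[OF is_hom_id]] mult_eq_0_iff)
  then obtain a b c where "eval3 (f * var_c) a b c \<noteq> 0"
    by (rule eval3_nonzeroE)
  hence abc: "eval3 f a b c \<noteq> 0" "c \<noteq> 0"
    by (auto simp: subst3_simps)
  \<comment> \<open>Evaluation at the point that undoes the translation by (x, y).\<close>
  define \<phi> where "\<phi> g = poly (map_poly (\<lambda>h. poly (map_poly (\<lambda>k. k) h) (a / c - x)) g) (b / c - y)"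
    for g :: "complex poly poly"
  have hom: "is_hom \<phi>"
    unfolding \<phi>_def[abs_def] by (intro is_hom_eval is_hom_id)
  have \<phi>: "\<phi> (const2 k) = k" "\<phi> var_X = a / c - x" "\<phi> var_Y = b / c - y" for k
    by (simp_all add: \<phi>_def const2_def var_X_def var_Y_def map_poly_pCons)
  have "\<phi> (subst3 const2 f (const2 x + var_X) (const2 y + var_Y) 1) = eval3 f (a / c) (b / c) 1"
    by (subst hom_subst3[OF hom is_hom_const2]) (simp add: \<phi> is_hom_simps[OF hom])
  hence "eval3 f (a / c) (b / c) 1 = 0"
    using * by (simp add: is_hom_zero[OF hom])
  moreover have "eval3 f a b c = c ^ e * eval3 f (a / c) (b / c) 1"
    using homogeneous3_subst3[OF assms(1) is_hom_id, of c "a / c" "b / c" 1] abc(2) by simp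
  ultimately show False using abc(1) by simp
qed

lemma lowest_degree_affine_ge:
  assumes "homogeneous3 e f" "f \<noteq> 0"
    and "\<And>\<mu>. [:0, 1:] ^ m dvd curve3 f [:x, \<mu>:] [:y, 1:] 1"
  shows "m \<le> lowest_degree (subst3 const2 f (const2 x + var_X) (const2 y + var_Y) 1)"
  using assms
  by (intro lowest_degree_ge affine_expansion_nonzero)
    (simp_all add: line2_subst3 line2_simps is_hom_simps[OF is_hom_line2])

lemma lowest_degree_affine_le:
  fixes A B C :: "complex poly" and x y :: complex
  defines "\<alpha> \<equiv> A - smult x C" and "\<beta> \<equiv> B - smult y C"
  assumes f: "homogeneous3 e f" "f \<noteq> 0" "curve3 f A B C = 0"
    and nz: "\<alpha> \<noteq> 0 \<or> \<beta> \<noteq> 0"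
    and simple: "\<And>t. poly \<alpha> t = 0 \<Longrightarrow> poly \<beta> t = 0 \<Longrightarrow>
      poly (pderiv \<alpha>) t \<noteq> 0 \<or> poly (pderiv \<beta>) t \<noteq> 0"
    and S: "finite S" "\<And>t. t \<notin> S \<Longrightarrow> poly C t \<noteq> 0"
    and inj: "\<And>t t'. t \<notin> S \<Longrightarrow> t' \<notin> S \<Longrightarrow> poly A t / poly C t = poly A t' / poly C t' \<Longrightarrow>
      poly B t / poly C t = poly B t' / poly C t' \<Longrightarrow> t = t'"
  shows "lowest_degree (subst3 const2 f (const2 x + var_X) (const2 y + var_Y) 1)
      + max (degree \<alpha>) (degree \<beta>) \<le> e + card {t. poly \<alpha> t = 0 \<and> poly \<beta> t = 0}"
proof (rule lowest_degree_bound[OF affine_expansion_nonzero[OF f(1,2)] _ _ nz simple S])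
  let ?g = "subst3 const2 f (const2 x + var_X) (const2 y + var_Y) 1"
  have line: "line2 \<mu> ?g = curve3 f [:x, \<mu>:] [:y, 1:] 1" for \<mu>
    by (simp add: line2_subst3 line2_simps is_hom_simps[OF is_hom_line2])
  show "degree (line2 \<mu> ?g) \<le> e" for \<mu>
    unfolding line by (rule degree_curve3_le[OF f(1)]) auto
  show "poly (line2 \<mu> ?g) (poly \<beta> t / poly C t) = 0"
    if "poly C t \<noteq> 0" "poly \<alpha> t = \<mu> * poly \<beta> t" for \<mu> t
  proof -
    have "x + poly \<beta> t / poly C t * \<mu> = poly A t / poly C t"
      "y + poly \<beta> t / poly C t = poly B t / poly C t"
      using that by (simp_all add: \<alpha>_def \<beta>_def field_simps)
    hence "poly (line2 \<mu> ?g) (poly \<beta> t / poly C t) = eval3 f (poly A t / poly C t) (poly B t / poly C t) 1"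
      by (simp add: line poly_curve3)
    moreover have "poly (curve3 f A B C) t =
        poly C t ^ e * eval3 f (poly A t / poly C t) (poly B t / poly C t) 1"
      using homogeneous3_subst3[OF f(1) is_hom_id, of "poly C t" "poly A t / poly C t" "poly B t / poly C t" 1]
        that(1) by (simp add: poly_curve3)
    ultimately show ?thesis
      using f(3) that(1) by simp
  qed
  have quot: "poly \<alpha> t / poly C t = poly A t / poly C t - x"
    "poly \<beta> t / poly C t = poly B t / poly C t - y" if "t \<notin> S" for t
    using S(2)[OF that] by (simp_all add: \<alpha>_def \<beta>_def diff_divide_distrib)
  show "t = t'" if "t \<notin> S" "t' \<notin> S" "poly \<alpha> t / poly C t = poly \<alpha> t' / poly C t'"
      "poly \<beta> t / poly C t = poly \<beta> t' / poly C t'" for t t'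
    using inj[of t t'] that by (simp add: quot)
qed assumption+

subsection \<open>The Chebyshev parametrization is an immersion, injective off the coordinate lines\<close>

lemma poly_cheb_add:
  "poly (cheb_S (m + n)) t = poly (cheb_S m) t * poly (cheb_T n) t + poly (cheb_T m) t * poly (cheb_S n) t"
  "poly (cheb_T (m + n)) t = poly (cheb_T m) t * poly (cheb_T n) t
    + (t\<^sup>2 - 1) * poly (cheb_S m) t * poly (cheb_S n) t"
  by (simp_all add: cheb_S_add cheb_T_add cheb_D_def)

lemma poly_cheb_diff:
  assumes "m \<le> n"
  shows "poly (cheb_S (n - m)) t = poly (cheb_S n) t * poly (cheb_T m) t - poly (cheb_T n) t * poly (cheb_S m) t"
    and "poly (cheb_T (n - m)) t = poly (cheb_T n) t * poly (cheb_T m) t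
      - (t\<^sup>2 - 1) * poly (cheb_S n) t * poly (cheb_S m) t"
  using assms by (simp_all add: cheb_S_diff cheb_T_diff cheb_D_def)

lemma poly_cheb_pell: "poly (cheb_T n) t ^ 2 = 1 + (t\<^sup>2 - 1) * poly (cheb_S n) t ^ 2"
  using arg_cong[OF cheb_pell[of n], of "\<lambda>p. poly p t"] by (simp add: cheb_D_def)

lemma poly_cheb_T_root: "poly (cheb_S n) t = 0 \<Longrightarrow> poly (cheb_T n) t = 1 \<or> poly (cheb_T n) t = - 1"
  using poly_cheb_pell[of n t] by (simp add: power2_eq_1_iff)

text \<open>a, b, c are the sides of a triangle with angles p\<theta>, q\<theta> and \<pi> - (p +
  q)\<theta>. Their ratios determine the cosines \<open>cheb_T p\<close> and \<open>cheb_T q\<close>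
  by the law of cosines, and Euclidean descent on the index recovers \<open>cheb_T 1\<close>, which
  is t.\<close>

lemma cheb_param_inj:
  assumes "coprime p q" "p > 0" "q > 0"
    and eq: "poly (cheb_S p) t' = k * poly (cheb_S p) t" "poly (cheb_S q) t' = k * poly (cheb_S q) t"
      "poly (cheb_S (p + q)) t' = k * poly (cheb_S (p + q)) t"
    and nz: "poly (cheb_S p) t \<noteq> 0" "poly (cheb_S q) t \<noteq> 0" "poly (cheb_S (p + q)) t \<noteq> 0" "k \<noteq> 0"
  shows "t = t'"
proof -
  have law_of_cosines: "B = (a\<^sup>2 + c\<^sup>2 - b\<^sup>2) / (2 * a * c) \<and> A = (b\<^sup>2 + c\<^sup>2 - a\<^sup>2) / (2 * b * c)"
    if "c = a * B + A * b" "A\<^sup>2 = 1 + d * a\<^sup>2" "B\<^sup>2 = 1 + d * b\<^sup>2" "a \<noteq> 0" "b \<noteq> 0" "c \<noteq> 0"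
    for a b c A B d :: complex
  proof -
    have "a\<^sup>2 + c\<^sup>2 - b\<^sup>2 = B * (2 * a * c)" "b\<^sup>2 + c\<^sup>2 - a\<^sup>2 = A * (2 * b * c)"
      using that(1-3) by algebra+
    thus ?thesis using that by simp
  qed
  have scale: "((k * a)\<^sup>2 + (k * c)\<^sup>2 - (k * b)\<^sup>2) / (2 * (k * a) * (k * c)) = (a\<^sup>2 + c\<^sup>2 - b\<^sup>2) / (2 * a * c)"
    for a b c
  proof -
    have eqs: "(k * a)\<^sup>2 + (k * c)\<^sup>2 - (k * b)\<^sup>2 = k\<^sup>2 * (a\<^sup>2 + c\<^sup>2 - b\<^sup>2)"
      "2 * (k * a) * (k * c) = k\<^sup>2 * (2 * a * c)"
      by (simp_all add: algebra_simps power2_eq_square)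
    show ?thesis
      unfolding eqs using nz(4) by simp
  qed
  have T: "poly (cheb_T p) t' = poly (cheb_T p) t" "poly (cheb_T q) t' = poly (cheb_T q) t"
    using law_of_cosines[OF poly_cheb_add(1) poly_cheb_pell poly_cheb_pell nz(1-3)]
      law_of_cosines[OF poly_cheb_add(1) poly_cheb_pell poly_cheb_pell, of p t' q] nz
    by (simp_all add: eq scale)
  have "(t'\<^sup>2 - 1) * (k * poly (cheb_S p) t)\<^sup>2 = (t\<^sup>2 - 1) * (poly (cheb_S p) t)\<^sup>2"
    using poly_cheb_pell[of p t] poly_cheb_pell[of p t'] by (simp add: T eq)
  hence D: "(t'\<^sup>2 - 1) * k\<^sup>2 = t\<^sup>2 - 1"
    using nz(1) by (simp add: power_mult_distrib)
  define P where "P n \<longleftrightarrow> poly (cheb_S n) t' = k * poly (cheb_S n) t \<and>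
    poly (cheb_T n) t' = poly (cheb_T n) t" for n
  have "P 1"
  proof (rule nat_coprime_descent[of P p q])
    show "P p" "P q"
      by (simp_all add: P_def eq T)
    fix i j assume *: "P i" "P j" "j < i"
    \<comment> \<open>Passing from t to t' scales each \<open>cheb_S\<close> by k; in the
      subtraction formula for \<open>cheb_T\<close> the resulting k^2 is compensated by
      \<open>D\<close>.\<close>
    have "(t'\<^sup>2 - 1) * poly (cheb_S i) t' * poly (cheb_S j) t'
        = (t\<^sup>2 - 1) * poly (cheb_S i) t * poly (cheb_S j) t"
      using * unfolding D[symmetric] P_def by (simp add: power2_eq_square mult_ac)
    thus "P (i - j)"
      using * unfolding P_def poly_cheb_diff[OF less_imp_le[OF *(3)]] by (simp add: right_diff_distrib mult_ac)
  qed (use assms in auto)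
  thus ?thesis
    by (simp add: P_def cheb_T_1)
qed

section \<open>Velocity of the parametrization\<close>

lemma poly_pderiv_cheb_S:
  "(t\<^sup>2 - 1) * poly (pderiv (cheb_S n)) t = of_nat n * poly (cheb_T n) t - t * poly (cheb_S n) t"
  using arg_cong[OF pderiv_cheb[THEN conjunct2], of "\<lambda>p. poly p t" n] by (simp add: cheb_D_def)

text \<open>At t = \<plusminus>1 the factor t^2 - 1 in \<open>poly_pderiv_cheb_S\<close> hides the
  derivative. Differentiating that equation once more exposes it, since the term with the second
  derivative drops out there.\<close>

lemma poly_pderiv_cheb_S_endpoint:
  assumes "t\<^sup>2 = 1"
  shows "3 * t * poly (pderiv (cheb_S n)) t = (of_nat n ^ 2 - 1) * poly (cheb_S n) t"
    and "n > 0 \<Longrightarrow> poly (cheb_S n) t \<noteq> 0"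
proof -
  have "pderiv (cheb_D * pderiv (cheb_S n)) = pderiv (of_nat n * cheb_T n - [:0, 1:] * cheb_S n)"
    using pderiv_cheb[of n] by simp
  hence "poly (pderiv (cheb_D * pderiv (cheb_S n))) t =
      poly (pderiv (of_nat n * cheb_T n - [:0, 1:] * cheb_S n)) t"
    by simp
  moreover have "pderiv (of_nat n :: complex poly) = 0"
    by (simp add: of_nat_poly pderiv_pCons)
  moreover have "t * (t * z) = z" for z
    using assms by (simp add: power2_eq_square flip: mult.assoc)
  ultimately show "3 * t * poly (pderiv (cheb_S n)) t = (of_nat n ^ 2 - 1) * poly (cheb_S n) t"
    using assms pderiv_cheb[of n]
    by (simp add: pderiv_mult pderiv_diff cheb_D_def pderiv_pCons power2_eq_square algebra_simps)
  have "of_nat n * poly (cheb_T n) t = t * poly (cheb_S n) t"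
    using poly_pderiv_cheb_S[of t n] assms by simp
  moreover have "poly (cheb_T n) t ^ 2 = 1"
    using poly_cheb_pell[of n t] assms by simp
  ultimately show "poly (cheb_S n) t \<noteq> 0" if "n > 0"
    using that by auto
qed

text \<open>At t = \<plusminus>1 the logarithmic derivatives depend on n^2, and p^2 differs from (p
  + q)^2. Elsewhere n T_n - t S_n replaces the derivative and the t-terms cancel in each minor; if
  S_p is nonzero, the two minors give T_{p+q} = T_p T_q, so S_q = 0 and then T_q = 0, against
  \<open>cheb_pell\<close>.\<close>

lemma cheb_param_immersion:
  fixes t :: complex
  assumes "coprime p q" "p > 0" "q > 0"
  defines "S \<equiv> \<lambda>n. poly (cheb_S n) t" and "S' \<equiv> \<lambda>n. poly (pderiv (cheb_S n)) t"
  assumes eq: "S p * S' q = S' p * S q" "S p * S' (p + q) = S' p * S (p + q)"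
  shows False
proof (cases "t\<^sup>2 = 1")
  case True
  have "3 * t * (S p * S' (p + q)) = 3 * t * (S' p * S (p + q))"
    using eq(2) by simp
  hence "S p * (3 * t * S' (p + q)) = (3 * t * S' p) * S (p + q)"
    by (simp add: algebra_simps)
  hence "S p * ((of_nat (p + q) ^ 2 - 1) * S (p + q)) = (of_nat p ^ 2 - 1) * S p * S (p + q)"
    unfolding S_def S'_def poly_pderiv_cheb_S_endpoint(1)[OF True] .
  moreover have "S p \<noteq> 0" "S (p + q) \<noteq> 0"
    using poly_pderiv_cheb_S_endpoint(2)[OF True] assms(2,3) by (auto simp: S_def)
  ultimately have "(of_nat (p + q) :: complex) ^ 2 = of_nat p ^ 2"
    by simp
  hence "(p + q) ^ 2 = p ^ 2"
    by (simp only: of_nat_power [symmetric] of_nat_eq_iff)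
  thus False using assms(3) by simp
next
  case False
  define d where "d = t\<^sup>2 - 1"
  have d: "d \<noteq> 0" using False by (simp add: d_def)
  define T where "T n = poly (cheb_T n) t" for n
  have S': "d * S' n = of_nat n * T n - t * S n" for n
    unfolding S_def S'_def T_def d_def by (rule poly_pderiv_cheb_S)
  have minor: "of_nat n * S m * T n = of_nat m * T m * S n" if "S m * S' n = S' m * S n" for m n
  proof -
    have "S m * (d * S' n) = (d * S' m) * S n"
      using that by (simp add: mult_ac)
    thus ?thesis unfolding S' by (simp add: algebra_simps)
  qed
  have 1: "of_nat q * S p * T q = of_nat p * T p * S q"
    and 2: "of_nat (p + q) * S p * T (p + q) = of_nat p * T p * S (p + q)"
    using minor[OF eq(1)] minor[OF eq(2)] by (simp_all only:)
  have add: "S (p + q) = S p * T q + T p * S q" "T (p + q) = T p * T q + d * S p * S q"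
    by (simp_all add: S_def T_def d_def poly_cheb_add)
  have pell: "T n ^ 2 = 1 + d * S n ^ 2" for n
    unfolding S_def T_def d_def by (rule poly_cheb_pell)
  have nz: "S p = 0 \<Longrightarrow> S q \<noteq> 0"
    using cheb_S_no_common_root[OF assms(1-3)] by (simp add: S_def)
  show False
  proof (cases "S p = 0")
    case True
    hence "T p = 0" using 1 nz assms(2) by simp
    thus False using pell[of p] True by simp
  next
    case False
    have 3: "of_nat p * S (p + q) = of_nat (p + q) * S p * T q"
      using 1 by (simp add: add algebra_simps)
    have "of_nat (p + q) * S p * T (p + q) = T p * (of_nat p * S (p + q))"
      unfolding 2 by (simp only: mult_ac)
    hence "of_nat (p + q) * S p * (T (p + q) - T p * T q) = 0"
      unfolding 3 right_diff_distrib by (simp only: mult_ac diff_self)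
    moreover have "of_nat (p + q) \<noteq> (0 :: complex)"
      using assms(2) by (simp only: of_nat_eq_0_iff)
    ultimately have "T (p + q) = T p * T q"
      using False by simp
    hence "S q = 0" using add(2) d False by simp
    hence "T q = 0" using 1 False assms(3) by simp
    thus False using pell[of q] \<open>S q = 0\<close> by simp
  qed
qed

subsection \<open>Points of the parametrized curve\<close>

lemma proportional_refl: "(x, y, z) \<noteq> (0, 0, 0) \<Longrightarrow> proportional (x, y, z) (x, y, z)"
  by (auto simp: proportional_def intro: exI[of _ 1])

lemma alg_mult_hpoint:
  "(x, y, z) \<noteq> (0, 0, 0) \<Longrightarrow> alg_mult f (hpoint x y z) = lowest_degree (local_expansion f (x, y, z))"
  unfolding hpoint_def by (rule alg_mult.abs_eq[OF proportional_refl])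

lemma cp2_cases:
  obtains x y z where "\<xi> = hpoint x y z" "(x, y, z) \<noteq> (0, 0, 0)"
proof -
  obtain x y z where v: "rep_cp2 \<xi> = (x, y, z)" by (cases "rep_cp2 \<xi>")
  have "abs_cp2 (rep_cp2 \<xi>) = \<xi>" "proportional (rep_cp2 \<xi>) (rep_cp2 \<xi>)"
    by (rule Quotient3_abs_rep[OF Quotient3_cp2] Quotient3_rep_reflp[OF Quotient3_cp2])+
  thus ?thesis
    by (intro that[of x y z]) (auto simp: hpoint_def proportional_def v)
qed

lemma hpoint_eq_iff_cross:
  assumes "(x, y, z) \<noteq> (0, 0, 0)" "(x', y', z') \<noteq> (0, 0, 0)"
  shows "hpoint x y z = hpoint x' y' z' \<longleftrightarrow> x * y' = x' * y \<and> x * z' = x' * z \<and> y * z' = y' * z"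
proof
  assume cross: "x * y' = x' * y \<and> x * z' = x' * z \<and> y * z' = y' * z"
  consider "x \<noteq> 0" | "y \<noteq> 0" | "z \<noteq> 0" using assms(1) by auto
  hence "\<exists>k. x' = k * x \<and> y' = k * y \<and> z' = k * z"
  proof cases
    case 1
    thus ?thesis using cross by (intro exI[of _ "x' / x"]) (auto simp: field_simps)
  next
    case 2
    thus ?thesis using cross by (intro exI[of _ "y' / y"]) (auto simp: field_simps)
  next
    case 3
    thus ?thesis using cross by (intro exI[of _ "z' / z"]) (auto simp: field_simps)
  qed
  then obtain k where k: "x' = k * x \<and> y' = k * y \<and> z' = k * z" ..
  moreover have "k \<noteq> 0" using k assms(2) by auto
  ultimately show "hpoint x y z = hpoint x' y' z'"
    using hpoint_eq_iff[OF assms] by blast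
qed (auto simp: hpoint_eq_iff[OF assms])

lemma coprime_add_right: "coprime p q \<Longrightarrow> coprime q (p + q)" for p q :: nat
  using gcd_add1[of p q] by (simp add: coprime_iff_gcd_eq_1 gcd.commute[of q])

locale cheb_pair =
  fixes p q :: nat
  assumes p_pos: "p > 0" and q_pos: "q > 0" and coprime: "coprime p q"
begin

abbreviation "\<Gamma>a \<equiv> cheb_S p"
abbreviation "\<Gamma>b \<equiv> cheb_S q"
abbreviation "\<Gamma>c \<equiv> cheb_S (p + q)"

lemma param_nonzero: "(poly \<Gamma>a t, poly \<Gamma>b t, poly \<Gamma>c t) \<noteq> (0, 0, 0)"
  using cheb_S_no_common_root[OF coprime p_pos q_pos] by auto

lemma param_eq_iff:
  assumes "(x, y, z) \<noteq> (0, 0, 0)"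
  shows "cheb_param p q t = hpoint x y z \<longleftrightarrow>
    poly \<Gamma>a t * y = x * poly \<Gamma>b t \<and> poly \<Gamma>a t * z = x * poly \<Gamma>c t \<and> poly \<Gamma>b t * z = y * poly \<Gamma>c t"
  unfolding cheb_param_def using p_pos q_pos
  by (simp add: cheb_U_eq_S hpoint_eq_iff_cross[OF param_nonzero assms] del: One_nat_def)

definition coord_params :: "complex set" where
  "coord_params = {t. poly (\<Gamma>a * \<Gamma>b * \<Gamma>c) t = 0}"

lemma finite_coord_params: "finite coord_params"
  using cheb_S_nonzero p_pos q_pos unfolding coord_params_def by (intro poly_roots_finite) simp

lemma coord_paramsD:
  assumes "t \<notin> coord_params"
  shows "poly \<Gamma>a t \<noteq> 0" "poly \<Gamma>b t \<noteq> 0" "poly \<Gamma>c t \<noteq> 0"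
  using assms by (auto simp: coord_params_def)

lemma param_inj:
  assumes "t \<notin> coord_params" "t' \<notin> coord_params"
    and "poly \<Gamma>a t' = k * poly \<Gamma>a t" "poly \<Gamma>b t' = k * poly \<Gamma>b t" "poly \<Gamma>c t' = k * poly \<Gamma>c t"
  shows "t = t'"
proof (rule cheb_param_inj[OF coprime p_pos q_pos assms(3-5) coord_paramsD[OF assms(1)]])
  show "k \<noteq> 0"
    using assms(3) coord_paramsD(1)[OF assms(2)] by auto
qed

text \<open>Stated for the three components in any order, so that it serves all three affine
  charts.\<close>

lemma param_inj_quotient:
  assumes "t \<notin> coord_params" "t' \<notin> coord_params" "{u, v, w} = {\<Gamma>a, \<Gamma>b, \<Gamma>c}"
    and "poly u t / poly w t = poly u t' / poly w t'" "poly v t / poly w t = poly v t' / poly w t'"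
  shows "t = t'"
proof -
  define k where "k = poly w t' / poly w t"
  have "w \<in> {\<Gamma>a, \<Gamma>b, \<Gamma>c}" using assms(3) by auto
  hence "poly w t \<noteq> 0" "poly w t' \<noteq> 0"
    using coord_paramsD[OF assms(1)] coord_paramsD[OF assms(2)] by auto
  hence "poly r t' = k * poly r t" if "r \<in> {u, v, w}" for r
    using that assms(4,5) by (auto simp: k_def field_simps)
  thus ?thesis
    unfolding assms(3) by (intro param_inj[OF assms(1,2), of k]) simp_all
qed

text \<open>A common double zero of two linear forms vanishing at the image point would make
  all \<open>2 \<times> 2\<close> minors of the position and velocity vectors vanish.\<close>

lemma param_simple:
  assumes "{u, v, w} = {\<Gamma>a, \<Gamma>b, \<Gamma>c}"
    and "poly (u - smult x w) t = 0" "poly (v - smult y w) t = 0"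
  shows "poly (pderiv (u - smult x w)) t \<noteq> 0 \<or> poly (pderiv (v - smult y w)) t \<noteq> 0"
proof (rule ccontr)
  assume "\<not> ?thesis"
  hence "\<exists>c. poly r t = c * poly w t \<and> poly (pderiv r) t = c * poly (pderiv w) t" if "r \<in> {u, v, w}" for r
    using that assms(2,3) by (auto simp: pderiv_diff pderiv_smult intro: exI[of _ 1])
  hence "poly r t * poly (pderiv r') t = poly (pderiv r) t * poly r' t"
    if "r \<in> {u, v, w}" "r' \<in> {u, v, w}" for r r'
    using that by (metis (no_types, lifting) mult.assoc mult.commute)
  thus False
    unfolding assms(1) using cheb_param_immersion[OF coprime p_pos q_pos, of t] by blast
qed

end

subsection \<open>Multiplicities\<close>

text \<open>\<open>swap_bc\<close> and \<open>rotate\<close> carry the charts b = 1 and a = 1 of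
  \<open>local_expansion\<close> to the chart c = 1, so that bounds need only be proved
  there.\<close>

definition swap_bc :: "poly3 \<Rightarrow> poly3" where
  "swap_bc f = subst3 const3 f var_a var_c var_b"

definition rotate :: "poly3 \<Rightarrow> poly3" where
  "rotate f = subst3 const3 f var_c var_a var_b"

lemma subst3_swap_bc: "is_hom \<iota> \<Longrightarrow> subst3 \<iota> (swap_bc f) x y z = subst3 \<iota> f x z y"
  and subst3_rotate: "is_hom \<iota> \<Longrightarrow> subst3 \<iota> (rotate f) x y z = subst3 \<iota> f z x y"
  by (simp_all add: swap_bc_def rotate_def subst3_subst3 subst3_simps)

lemma
  assumes "f \<noteq> 0"
  shows swap_bc_nonzero: "swap_bc f \<noteq> 0" and rotate_nonzero: "rotate f \<noteq> 0"
proof -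
  obtain x y z where "eval3 f x y z \<noteq> 0"
    using eval3_nonzeroE[OF assms] .
  hence "eval3 (swap_bc f) x z y \<noteq> 0" "eval3 (rotate f) y z x \<noteq> 0"
    by (simp_all add: subst3_swap_bc subst3_rotate)
  thus "swap_bc f \<noteq> 0" "rotate f \<noteq> 0"
    by (metis is_hom_zero[OF is_hom_subst3[OF is_hom_id]])+
qed

lemma
  assumes "homogeneous3 e f"
  shows homogeneous3_swap_bc: "homogeneous3 e (swap_bc f)"
    and homogeneous3_rotate: "homogeneous3 e (rotate f)"
  using homogeneous3_subst3_forms[OF assms homogeneous3_var(1,3,2)]
    homogeneous3_subst3_forms[OF assms homogeneous3_var(3,1,2)]
  by (simp_all add: swap_bc_def rotate_def)

abbreviation affine_expansion :: "poly3 \<Rightarrow> complex \<Rightarrow> complex \<Rightarrow> complex poly poly" where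
  "affine_expansion f x y \<equiv> subst3 const2 f (const2 x + var_X) (const2 y + var_Y) 1"

lemma alg_mult_charts:
  "z \<noteq> 0 \<Longrightarrow> alg_mult f (hpoint x y z) = lowest_degree (affine_expansion f (x / z) (y / z))"
  "y \<noteq> 0 \<Longrightarrow> alg_mult f (hpoint x y 0) = lowest_degree (affine_expansion (swap_bc f) (x / y) 0)"
  "x \<noteq> 0 \<Longrightarrow> alg_mult f (hpoint x 0 0) = lowest_degree (affine_expansion (rotate f) 0 0)"
  by (simp_all add: alg_mult_hpoint local_expansion_def subst3_swap_bc subst3_rotate)

lemma vanishes_to_order_imp_alg_mult_ge:
  assumes "homogeneous3 e f" "f \<noteq> 0" "(x, y, z) \<noteq> (0, 0, 0)" "vanishes_to_order m f x y z"
  shows "m \<le> alg_mult f (hpoint x y z)"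
proof -
  have scaled: "vanishes_to_order m f (x / k) (y / k) (z / k)" if "k \<noteq> 0" for k
    using vanishes_to_order_scale[OF assms(1,4), of "inverse k"] that by (simp add: divide_inverse mult.commute)
  consider "z \<noteq> 0" | "z = 0" "y \<noteq> 0" | "z = 0" "y = 0" "x \<noteq> 0"
    using assms(3) by auto
  thus ?thesis
  proof cases
    case 1
    have "[:0, 1:] ^ m dvd curve3 f [:x / z, \<mu>:] [:y / z, 1:] 1" for \<mu>
      using scaled[OF 1] 1 by (intro vanishes_to_orderD) simp
    from lowest_degree_affine_ge[OF assms(1,2) this] show ?thesis
      by (simp add: alg_mult_charts 1)
  next
    case 2
    have "[:0, 1:] ^ m dvd curve3 f [:x / y, \<mu>:] 1 [:0, 1:]" for \<mu>
      using scaled[OF 2(2)] 2 by (intro vanishes_to_orderD) simp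
    hence "[:0, 1:] ^ m dvd curve3 (swap_bc f) [:x / y, \<mu>:] [:0, 1:] 1" for \<mu>
      by (simp add: subst3_swap_bc)
    from lowest_degree_affine_ge[OF homogeneous3_swap_bc[OF assms(1)] swap_bc_nonzero[OF assms(2)] this]
    show ?thesis by (simp add: alg_mult_charts 2)
  next
    case 3
    have "[:0, 1:] ^ m dvd curve3 f 1 [:0, \<mu>:] [:0, 1:]" for \<mu>
      using scaled[OF 3(3)] 3 by (intro vanishes_to_orderD) simp
    hence "[:0, 1:] ^ m dvd curve3 (rotate f) [:0, \<mu>:] [:0, 1:] 1" for \<mu>
      by (simp add: subst3_rotate)
    from lowest_degree_affine_ge[OF homogeneous3_rotate[OF assms(1)] rotate_nonzero[OF assms(2)] this]
    show ?thesis by (simp add: alg_mult_charts 3)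
  qed
qed

section \<open>Upper bounds for multiplicities from parameter counts\<close>

context cheb_pair
begin

lemma vanishes_iff: "vanishes_on_param p q f \<longleftrightarrow> curve3 f \<Gamma>a \<Gamma>b \<Gamma>c = 0"
  using vanishes_on_param_iff p_pos q_pos .

text \<open>Only the third component has degree p + q - 1. Hence the pencil of lines through a point
  reaches that degree unless x = y = 0, which is why G_0 is treated apart.\<close>

lemma coeff_top: "coeff \<Gamma>a (p + q - 1) = 0" "coeff \<Gamma>b (p + q - 1) = 0" "coeff \<Gamma>c (p + q - 1) \<noteq> 0"
proof -
  show "coeff \<Gamma>a (p + q - 1) = 0" "coeff \<Gamma>b (p + q - 1) = 0"
    using p_pos q_pos by (auto intro!: coeff_eq_0 simp: degree_cheb_S)
  have "lead_coeff \<Gamma>c \<noteq> 0"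
    using cheb_S_nonzero[of "p + q"] p_pos by simp
  thus "coeff \<Gamma>c (p + q - 1) \<noteq> 0"
    unfolding degree_cheb_S .
qed

lemma affine_bound:
  assumes "homogeneous3 e f" "f \<noteq> 0" "curve3 f u v w = 0" "{u, v, w} = {\<Gamma>a, \<Gamma>b, \<Gamma>c}"
    and "u - smult x w \<noteq> 0 \<or> v - smult y w \<noteq> 0"
  shows "lowest_degree (affine_expansion f x y) + max (degree (u - smult x w)) (degree (v - smult y w))
    \<le> e + card {t. poly (u - smult x w) t = 0 \<and> poly (v - smult y w) t = 0}"
proof (rule lowest_degree_affine_le[OF assms(1-3,5) param_simple[OF assms(4)] finite_coord_params])
  show "poly w t \<noteq> 0" if "t \<notin> coord_params" for t
  proof -
    have "w \<in> {\<Gamma>a, \<Gamma>b, \<Gamma>c}" using assms(4) by auto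
    thus ?thesis using coord_paramsD[OF that] by auto
  qed
  show "t = t'" if "t \<notin> coord_params" "t' \<notin> coord_params"
    "poly u t / poly w t = poly u t' / poly w t'" "poly v t / poly w t = poly v t' / poly w t'" for t t'
    using param_inj_quotient[OF that(1,2) assms(4) that(3,4)] .
qed

lemma alg_mult_le:
  assumes "homogeneous3 e f" "f \<noteq> 0" "vanishes_on_param p q f" "(x, y) \<noteq> (0, 0)"
  shows "alg_mult f (hpoint x y z) + (p + q - 1) \<le> e + card {t. cheb_param p q t = hpoint x y z}"
proof -
  have vanish: "curve3 f \<Gamma>a \<Gamma>b \<Gamma>c = 0"
    using assms(3) by (simp add: vanishes_iff)
  have preimage: "cheb_param p q t = hpoint x y z \<longleftrightarrow>
    poly \<Gamma>a t * y = x * poly \<Gamma>b t \<and> poly \<Gamma>a t * z = x * poly \<Gamma>c t \<and> poly \<Gamma>b t * z = y * poly \<Gamma>c t" for t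
    using assms(4) by (intro param_eq_iff) auto
  have top: "p + q - 1 \<le> max (degree r) (degree s)"
    if "coeff r (p + q - 1) \<noteq> 0 \<or> coeff s (p + q - 1) \<noteq> 0" for r s :: "complex poly"
    using that le_degree[of r] le_degree[of s] by (auto simp: le_max_iff_disj)
  have nz: "r \<noteq> 0 \<or> s \<noteq> 0"
    if "coeff r (p + q - 1) \<noteq> 0 \<or> coeff s (p + q - 1) \<noteq> 0" for r s :: "complex poly"
    using that by auto
  consider "z \<noteq> 0" | "z = 0" "y \<noteq> 0" | "z = 0" "y = 0" "x \<noteq> 0"
    using assms(4) by auto
  thus ?thesis
  proof cases
    case 1
    let ?r = "\<Gamma>a - smult (x / z) \<Gamma>c" and ?s = "\<Gamma>b - smult (y / z) \<Gamma>c"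
    have deg: "coeff ?r (p + q - 1) \<noteq> 0 \<or> coeff ?s (p + q - 1) \<noteq> 0"
      using assms(4) 1 coeff_top by auto
    have "{t. poly ?r t = 0 \<and> poly ?s t = 0} = {t. cheb_param p q t = hpoint x y z}"
    proof -
      have cross: "a * y = x * b" if "a * z = x * c" "b * z = y * c" for a b c
      proof -
        have "z * (a * y) = z * (x * b)"
          using that by algebra
        thus ?thesis using 1 by simp
      qed
      have "poly ?r t = 0 \<longleftrightarrow> poly \<Gamma>a t * z = x * poly \<Gamma>c t" "poly ?s t = 0 \<longleftrightarrow> poly \<Gamma>b t * z = y * poly \<Gamma>c t" for t
        using 1 by (auto simp: field_simps)
      thus ?thesis
        unfolding preimage using cross by blast
    qed
    thus ?thesis
      using affine_bound[OF assms(1,2) vanish refl nz[OF deg]] top[OF deg]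
      by (simp add: alg_mult_charts 1)
  next
    case 2
    let ?r = "\<Gamma>a - smult (x / y) \<Gamma>b" and ?s = "\<Gamma>c - smult 0 \<Gamma>b"
    have deg: "coeff ?r (p + q - 1) \<noteq> 0 \<or> coeff ?s (p + q - 1) \<noteq> 0"
      using coeff_top by simp
    have "{t. poly ?r t = 0 \<and> poly ?s t = 0} = {t. cheb_param p q t = hpoint x y z}"
      unfolding preimage using 2 by (auto simp: field_simps)
    moreover have "curve3 (swap_bc f) \<Gamma>a \<Gamma>c \<Gamma>b = 0"
      using vanish by (simp add: subst3_swap_bc)
    moreover have "{\<Gamma>a, \<Gamma>c, \<Gamma>b} = {\<Gamma>a, \<Gamma>b, \<Gamma>c}" by auto
    ultimately show ?thesis
      using affine_bound[OF homogeneous3_swap_bc[OF assms(1)] swap_bc_nonzero[OF assms(2)] _ _ nz[OF deg]]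
        top[OF deg]
      by (simp add: alg_mult_charts 2)
  next
    case 3
    let ?r = "\<Gamma>b - smult 0 \<Gamma>a" and ?s = "\<Gamma>c - smult 0 \<Gamma>a"
    have deg: "coeff ?r (p + q - 1) \<noteq> 0 \<or> coeff ?s (p + q - 1) \<noteq> 0"
      using coeff_top by simp
    have "{t. poly ?r t = 0 \<and> poly ?s t = 0} = {t. cheb_param p q t = hpoint x y z}"
      unfolding preimage using 3 by auto
    moreover have "curve3 (rotate f) \<Gamma>b \<Gamma>c \<Gamma>a = 0"
      using vanish by (simp add: subst3_rotate)
    moreover have "{\<Gamma>b, \<Gamma>c, \<Gamma>a} = {\<Gamma>a, \<Gamma>b, \<Gamma>c}" by auto
    ultimately show ?thesis
      using affine_bound[OF homogeneous3_rotate[OF assms(1)] rotate_nonzero[OF assms(2)] _ _ nz[OF deg]]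
        top[OF deg]
      by (simp add: alg_mult_charts 3)
  qed
qed

text \<open>The source point is the image of \<open>t = \<infinity>\<close>, so it is not counted by parameters.\<close>

lemma alg_mult_G_zero_le:
  assumes "homogeneous3 e f" "f \<noteq> 0" "vanishes_on_param p q f"
  shows "alg_mult f (hpoint 0 0 1) + (q - 1) \<le> e"
proof -
  have "curve3 f \<Gamma>a \<Gamma>b \<Gamma>c = 0"
    using assms(3) by (simp add: vanishes_iff)
  moreover have "\<Gamma>a - smult 0 \<Gamma>c \<noteq> 0 \<or> \<Gamma>b - smult 0 \<Gamma>c \<noteq> 0"
    using cheb_S_nonzero p_pos by simp
  moreover have no_params: "{t. poly (\<Gamma>a - smult 0 \<Gamma>c) t = 0 \<and> poly (\<Gamma>b - smult 0 \<Gamma>c) t = 0} = {}"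
    using cheb_S_no_common_root[OF coprime p_pos q_pos] by auto
  ultimately show ?thesis
    using affine_bound[OF assms(1,2) _ refl, of 0 0] unfolding no_params
    by (simp add: alg_mult_charts degree_cheb_S)
qed

lemma not_on_curve: "{t. cheb_param p q t = hpoint 1 0 0} = {}"
  using cheb_S_no_common_root[OF coprime_add_right[OF coprime]] p_pos q_pos
  by (auto simp: param_eq_iff)

text \<open>Parameters on coordinate lines land in gate points: if a or b is 0, then c is
  \<plusminus> the other one because \<open>cheb_T\<close> is \<plusminus>1 at roots of
  \<open>cheb_S\<close>; if c = 0, the law of cosines degenerates to b^2 = a^2. Any other point has
  its parameters where \<Gamma> is injective.\<close>

lemma param_card_le_1:
  assumes "hpoint x y z \<notin> gate_points" "(x, y) \<noteq> (0, 0)"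
  shows "card {t. cheb_param p q t = hpoint x y z} \<le> 1"
proof -
  have "t \<notin> coord_params" if "cheb_param p q t = hpoint x y z" for t
  proof
    assume "t \<in> coord_params"
    hence zero: "poly \<Gamma>a t = 0 \<or> poly \<Gamma>b t = 0 \<or> poly \<Gamma>c t = 0"
      by (auto simp: coord_params_def)
    have eq: "poly \<Gamma>c t = poly \<Gamma>a t * poly (cheb_T q) t + poly (cheb_T p) t * poly \<Gamma>b t"
      by (rule poly_cheb_add)
    have "poly \<Gamma>b t = poly \<Gamma>a t \<or> poly \<Gamma>b t = - poly \<Gamma>a t" if "poly \<Gamma>c t = 0"
    proof -
      have law_of_cosines: "b\<^sup>2 = a\<^sup>2"
        if "a * B + A * b = 0" "A\<^sup>2 = 1 + d * a\<^sup>2" "B\<^sup>2 = 1 + d * b\<^sup>2" for a b A B d :: complex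
        using that by algebra
      have "poly \<Gamma>b t ^ 2 = poly \<Gamma>a t ^ 2"
        by (rule law_of_cosines[OF _ poly_cheb_pell poly_cheb_pell]) (use that eq in simp)
      thus ?thesis
        by (simp add: power2_eq_iff)
    qed
    hence "cheb_param p q t \<in> gate_points"
      using zero eq poly_cheb_T_root[of p t] poly_cheb_T_root[of q t]
      by (auto simp: gate_points_def E_plus_def E_minus_def F_plus_def F_minus_def G_plus_def
          G_minus_def param_eq_iff)
    thus False using that assms(1) by simp
  qed
  hence "t = t'" if "cheb_param p q t = hpoint x y z" "cheb_param p q t' = hpoint x y z" for t t'
  proof -
    have t: "t \<notin> coord_params" "t' \<notin> coord_params"
      using that \<open>\<And>t. cheb_param p q t = hpoint x y z \<Longrightarrow> t \<notin> coord_params\<close> by auto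
    have "cheb_param p q t = hpoint (poly \<Gamma>a t') (poly \<Gamma>b t') (poly \<Gamma>c t')"
      using that p_pos q_pos by (simp add: cheb_param_def cheb_U_eq_S del: One_nat_def)
    hence "poly \<Gamma>a t / poly \<Gamma>c t = poly \<Gamma>a t' / poly \<Gamma>c t'" "poly \<Gamma>b t / poly \<Gamma>c t = poly \<Gamma>b t' / poly \<Gamma>c t'"
      using coord_paramsD[OF t(1)] coord_paramsD[OF t(2)]
      by (auto simp: param_eq_iff[OF param_nonzero] field_simps)
    thus ?thesis by (rule param_inj_quotient[OF t refl])
  qed
  hence "{t. cheb_param p q t = hpoint x y z} = {} \<or> (\<exists>t. {t. cheb_param p q t = hpoint x y z} = {t})"
    by blast
  thus ?thesis by auto
qed

end

subsection \<open>Counting the parameters of the gate points\<close>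

lemma poly_cheb_cos:
  "poly (cheb_S n) (complex_of_real (cos \<theta>)) * of_real (sin \<theta>) = of_real (sin (real n * \<theta>)) \<and>
   poly (cheb_T n) (complex_of_real (cos \<theta>)) = of_real (cos (real n * \<theta>))"
proof (induction n)
  case (Suc n)
  let ?S = "poly (cheb_S n) (complex_of_real (cos \<theta>))"
  have angle: "real (Suc n) * \<theta> = real n * \<theta> + \<theta>"
    by (simp add: algebra_simps)
  have "(complex_of_real (cos \<theta>))\<^sup>2 - 1 = - (of_real (sin \<theta>))\<^sup>2"
  proof -
    have "complex_of_real ((cos \<theta>)\<^sup>2) = of_real (1 - (sin \<theta>)\<^sup>2)"
      by (simp only: cos_squared_eq)
    thus ?thesis by simp
  qed
  moreover have "?S * of_real (sin \<theta>) = of_real (sin (real n * \<theta>))"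
    using Suc by blast
  ultimately have "((complex_of_real (cos \<theta>))\<^sup>2 - 1) * ?S = - of_real (sin \<theta>) * of_real (sin (real n * \<theta>))"
    by (simp add: power2_eq_square mult_ac)
  thus ?case using Suc
    unfolding angle cos_add sin_add
    by (simp add: cheb_S_Suc cheb_T_Suc cheb_D_def algebra_simps)
qed simp

lemma card_parity:
  "card {k \<in> {1..<n}. even k} = (n - 1) div 2 \<and> card {k \<in> {1..<n}. odd k} = n div 2"
proof (induction n)
  case (Suc n)
  show ?case
  proof (cases "n = 0")
    case False
    have "{k \<in> {1..<Suc n}. P k} = (if P n then insert n {k \<in> {1..<n}. P k} else {k \<in> {1..<n}. P k})"
      for P using False by (auto simp: less_Suc_eq)
    hence "card {k \<in> {1..<Suc n}. P k} = card {k \<in> {1..<n}. P k} + (if P n then 1 else 0)" for P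
      by simp
    moreover have "(n - 1) div 2 + (if even n then 1 else 0) = n div 2"
      "n div 2 + (if odd n then 1 else 0) = Suc n div 2"
      using False by presburger+
    ultimately show ?thesis using Suc.IH by simp
  qed simp
qed simp

text \<open>The values cos (k\<pi>/n) with 0 < k < n are n - 1 distinct roots, hence all of them by
  degree. There \<open>cheb_T n\<close> is (-1)^k, so the counts are those of even and odd
  k.\<close>

lemma
  assumes "n > 0"
  shows finite_cheb_S_roots: "finite {t. poly (cheb_S n) t = 0 \<and> Q t}"
    and card_cheb_T_eq_1: "card {t. poly (cheb_S n) t = 0 \<and> poly (cheb_T n) t = 1} = (n - 1) div 2"
    and card_cheb_T_eq_minus_1: "card {t. poly (cheb_S n) t = 0 \<and> poly (cheb_T n) t = - 1} = n div 2"
proof -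
  define x where "x k = complex_of_real (cos (real k * pi / real n))" for k
  have range: "0 < real k * pi / real n" "real k * pi / real n < pi" if "k \<in> {1..<n}" for k
    using that assms by (auto simp: field_simps)
  have "inj_on x {1..<n}"
  proof (rule inj_onI)
    fix k l assume *: "k \<in> {1..<n}" "l \<in> {1..<n}" "x k = x l"
    hence eq: "cos (real k * pi / real n) = cos (real l * pi / real n)"
      unfolding x_def of_real_eq_iff by simp
    note r = range[OF *(1)] range[OF *(2)]
    have "real k * pi / real n = real l * pi / real n"
      by (rule cos_inj_pi[OF less_imp_le[OF r(1)] less_imp_le[OF r(2)]
            less_imp_le[OF r(3)] less_imp_le[OF r(4)] eq])
    thus "k = l" using assms by simp
  qed
  have root: "poly (cheb_S n) (x k) = 0 \<and> poly (cheb_T n) (x k) = (- 1) ^ k" if "k \<in> {1..<n}" for k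
  proof -
    have "real n * (real k * pi / real n) = real k * pi"
      using assms by simp
    moreover have "sin (real k * pi / real n) \<noteq> 0"
      using sin_gt_zero[OF range[OF that]] by simp
    ultimately show ?thesis
      using poly_cheb_cos[of n "real k * pi / real n"] by (simp add: x_def cos_npi)
  qed
  have fin: "finite {t. poly (cheb_S n) t = 0}"
    using cheb_S_nonzero[OF assms] by (rule poly_roots_finite)
  thus "finite {t. poly (cheb_S n) t = 0 \<and> Q t}"
    by (rule rev_finite_subset) auto
  have img: "x ` {1..<n} = {t. poly (cheb_S n) t = 0}"
  proof (rule card_seteq[OF fin])
    show "x ` {1..<n} \<subseteq> {t. poly (cheb_S n) t = 0}"
      using root by auto
    show "card {t. poly (cheb_S n) t = 0} \<le> card (x ` {1..<n})"
      unfolding card_image[OF \<open>inj_on x {1..<n}\<close>]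
      using card_poly_roots_bound[OF cheb_S_nonzero[OF assms]] by (simp add: degree_cheb_S)
  qed
  have eq: "{t. poly (cheb_S n) t = 0 \<and> poly (cheb_T n) t = c} = x ` {k \<in> {1..<n}. (- 1) ^ k = c}" for c
  proof -
    have "{t. poly (cheb_S n) t = 0 \<and> poly (cheb_T n) t = c} = {t \<in> x ` {1..<n}. poly (cheb_T n) t = c}"
      unfolding img by simp
    also have "\<dots> = x ` {k \<in> {1..<n}. poly (cheb_T n) (x k) = c}"
      by blast
    also have "{k \<in> {1..<n}. poly (cheb_T n) (x k) = c} = {k \<in> {1..<n}. (- 1) ^ k = c}"
      using root by auto
    finally show ?thesis .
  qed
  have card: "card (x ` {k \<in> {1..<n}. P k}) = card {k \<in> {1..<n}. P k}" for P
    by (rule card_image) (rule inj_on_subset[OF \<open>inj_on x {1..<n}\<close>], auto)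
  have "(- 1 :: complex) ^ k = 1 \<longleftrightarrow> even k" "(- 1 :: complex) ^ k = - 1 \<longleftrightarrow> odd k" for k :: nat
    by (cases "even k"; simp)+
  thus "card {t. poly (cheb_S n) t = 0 \<and> poly (cheb_T n) t = 1} = (n - 1) div 2"
    "card {t. poly (cheb_S n) t = 0 \<and> poly (cheb_T n) t = - 1} = n div 2"
    unfolding eq card using card_parity[of n] by simp_all
qed

context cheb_pair
begin

text \<open>The addition formula leaves c = T_p b where a = 0, and c = T_q a where b = 0. Where c =
  0, the subtraction formula gives a = -T_{p+q} b, so the sign at G is reversed.\<close>

lemma gate_params:
  "{t. cheb_param p q t = E_plus} = {t. poly \<Gamma>a t = 0 \<and> poly (cheb_T p) t = 1}"
  "{t. cheb_param p q t = E_minus} = {t. poly \<Gamma>a t = 0 \<and> poly (cheb_T p) t = - 1}"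
  "{t. cheb_param p q t = F_plus} = {t. poly \<Gamma>b t = 0 \<and> poly (cheb_T q) t = 1}"
  "{t. cheb_param p q t = F_minus} = {t. poly \<Gamma>b t = 0 \<and> poly (cheb_T q) t = - 1}"
  "{t. cheb_param p q t = G_plus} = {t. poly \<Gamma>c t = 0 \<and> poly (cheb_T (p + q)) t = - 1}"
  "{t. cheb_param p q t = G_minus} = {t. poly \<Gamma>c t = 0 \<and> poly (cheb_T (p + q)) t = 1}"
proof -
  have c: "poly \<Gamma>c t = poly \<Gamma>a t * poly (cheb_T q) t + poly (cheb_T p) t * poly \<Gamma>b t" for t
    by (rule poly_cheb_add)
  have a: "poly \<Gamma>a t = poly \<Gamma>c t * poly (cheb_T q) t - poly (cheb_T (p + q)) t * poly \<Gamma>b t" for t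
    using poly_cheb_diff(1)[of q "p + q" t] by simp
  have nz: "poly \<Gamma>a t \<noteq> 0 \<or> poly \<Gamma>b t \<noteq> 0" for t
    using cheb_S_no_common_root[OF coprime p_pos q_pos] by blast
  have cancel: "- b = A * b \<longleftrightarrow> A = - 1" "- b = b * A \<longleftrightarrow> A = - 1"
    "A * b = - b \<longleftrightarrow> A = - 1" "b * A = - b \<longleftrightarrow> A = - 1"
    "- (A * b) = b \<longleftrightarrow> A = - 1" "b = - (A * b) \<longleftrightarrow> A = - 1" if "b \<noteq> 0" for A b :: complex
    using mult_cancel_right[of A b "- 1"] that
    by (auto simp: mult.commute[of b] minus_equation_iff equation_minus_iff[of b])
  have "cheb_param p q t = E_plus \<longleftrightarrow> poly \<Gamma>a t = 0 \<and> poly (cheb_T p) t = 1"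
    "cheb_param p q t = E_minus \<longleftrightarrow> poly \<Gamma>a t = 0 \<and> poly (cheb_T p) t = - 1" for t
    using nz[of t] c[of t]
    by (auto simp: E_plus_def E_minus_def param_eq_iff cancel)
  moreover have "cheb_param p q t = F_plus \<longleftrightarrow> poly \<Gamma>b t = 0 \<and> poly (cheb_T q) t = 1"
    "cheb_param p q t = F_minus \<longleftrightarrow> poly \<Gamma>b t = 0 \<and> poly (cheb_T q) t = - 1" for t
    using nz[of t] c[of t]
    by (auto simp: F_plus_def F_minus_def param_eq_iff cancel)
  moreover have "cheb_param p q t = G_plus \<longleftrightarrow> poly \<Gamma>c t = 0 \<and> poly (cheb_T (p + q)) t = - 1"
    "cheb_param p q t = G_minus \<longleftrightarrow> poly \<Gamma>c t = 0 \<and> poly (cheb_T (p + q)) t = 1" for t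
    using nz[of t] a[of t]
    by (auto simp: G_plus_def G_minus_def param_eq_iff cancel)
  ultimately show
    "{t. cheb_param p q t = E_plus} = {t. poly \<Gamma>a t = 0 \<and> poly (cheb_T p) t = 1}"
    "{t. cheb_param p q t = E_minus} = {t. poly \<Gamma>a t = 0 \<and> poly (cheb_T p) t = - 1}"
    "{t. cheb_param p q t = F_plus} = {t. poly \<Gamma>b t = 0 \<and> poly (cheb_T q) t = 1}"
    "{t. cheb_param p q t = F_minus} = {t. poly \<Gamma>b t = 0 \<and> poly (cheb_T q) t = - 1}"
    "{t. cheb_param p q t = G_plus} = {t. poly \<Gamma>c t = 0 \<and> poly (cheb_T (p + q)) t = - 1}"
    "{t. cheb_param p q t = G_minus} = {t. poly \<Gamma>c t = 0 \<and> poly (cheb_T (p + q)) t = 1}"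
    by simp_all
qed

lemma finite_gate_params:
  assumes "\<xi> \<in> gate_points"
  shows "finite {t. cheb_param p q t = \<xi>}"
  using assms p_pos q_pos finite_cheb_S_roots
  by (auto simp: gate_points_def gate_params)

lemma card_gate_params:
  "card {t. cheb_param p q t = E_plus} = (p - 1) div 2"
  "card {t. cheb_param p q t = E_minus} = p div 2"
  "card {t. cheb_param p q t = F_plus} = (q - 1) div 2"
  "card {t. cheb_param p q t = F_minus} = q div 2"
  "card {t. cheb_param p q t = G_plus} = (p + q) div 2"
  "card {t. cheb_param p q t = G_minus} = (p + q - 1) div 2"
  using p_pos q_pos by (simp_all only: gate_params card_cheb_T_eq_1 card_cheb_T_eq_minus_1 add_pos_pos)

end

subsection \<open>Uniqueness of the defining form and the proper transform\<close>

lemma vanishes_to_order_const3_mult: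
  "vanishes_to_order m f x y z \<Longrightarrow> vanishes_to_order m (const3 k * f) x y z"
  by (auto simp: vanishes_to_order_def subst3_simps intro: dvd_smult)

lemma gate_form_const3_mult:
  assumes "gate_form p q f" "k \<noteq> 0"
  shows "gate_form p q (const3 k * f)"
  using assms homogeneous3_mult[OF homogeneous3_const3, of _ f k]
  by (auto simp: gate_form_def vanishes_on_param_def subst3_simps intro!: vanishes_to_order_const3_mult)

context cheb_pair
begin

lemma degree_minimal:
  assumes "homogeneous3 e g" "g \<noteq> 0" "vanishes_on_param p q g"
  shows "p + q - 1 \<le> e"
  using alg_mult_le[OF assms, of 1 0 0] by (simp add: not_on_curve)

text \<open>In the minimal degree the bound at [1:0:0] leaves no room for positive multiplicity.
  Evaluation there is thus a linear functional without kernel on these forms, which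
  \<open>form_unique\<close> uses to normalise.\<close>

lemma eval3_nonzero:
  assumes "homogeneous3 (p + q - 1) g" "g \<noteq> 0" "vanishes_on_param p q g"
  shows "eval3 g 1 0 0 \<noteq> 0"
proof
  assume *: "eval3 g 1 0 0 = 0"
  have "vanishes_to_order 1 g 1 0 0"
    unfolding vanishes_to_order_def
  proof (intro allI impI)
    fix u v w :: "complex poly"
    assume "poly u 0 = 1" "poly v 0 = 0" "poly w 0 = 0"
    hence "[:- 0, 1:] dvd curve3 g u v w"
      unfolding poly_eq_0_iff_dvd[symmetric] by (simp add: poly_curve3 *)
    thus "[:0, 1:] ^ 1 dvd curve3 g u v w" by simp
  qed
  hence "1 \<le> alg_mult g (hpoint 1 0 0)"
    by (intro vanishes_to_order_imp_alg_mult_ge[OF assms(1,2)]) simp_all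
  thus False
    using alg_mult_le[OF assms, of 1 0 0] by (simp add: not_on_curve)
qed

lemma form_unique:
  assumes f: "homogeneous3 (p + q - 1) f" "f \<noteq> 0" "vanishes_on_param p q f"
    and g: "homogeneous3 (p + q - 1) g" "g \<noteq> 0" "vanishes_on_param p q g"
  obtains k where "k \<noteq> 0" "g = const3 k * f"
proof -
  define k where "k = eval3 g 1 0 0 / eval3 f 1 0 0"
  have "homogeneous3 (0 + (p + q - 1)) (const3 k * f)"
    by (rule homogeneous3_mult[OF homogeneous3_const3 f(1)])
  hence "homogeneous3 (p + q - 1) (g - const3 k * f)"
    using g(1) by (intro homogeneous3_diff) simp_all
  moreover have "vanishes_on_param p q (g - const3 k * f)"
    using f(3) g(3) by (simp add: vanishes_iff subst3_simps)
  moreover have "eval3 (g - const3 k * f) 1 0 0 = 0"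
    using eval3_nonzero[OF f] by (simp add: subst3_simps k_def)
  ultimately have "g - const3 k * f = 0"
    using eval3_nonzero by blast
  moreover have "k \<noteq> 0"
    using eval3_nonzero[OF f] eval3_nonzero[OF g] by (simp add: k_def)
  ultimately show ?thesis by (intro that[of k]) auto
qed

lemma gate_form_unique:
  assumes "gate_form p q f" "gate_form p q g"
  obtains k where "k \<noteq> 0" "g = const3 k * f"
  using assms form_unique[of f g] by (auto simp: gate_form_def)

text \<open>The descent produces some form of degree p + q - 1; the representative picked by choice
  is a multiple of it and so inherits the gate orders.\<close>

lemma gate_form_cheb_form: "gate_form p q (cheb_form p q)"
proof -
  obtain f where f: "gate_form p q f"
    using gate_form_exists[OF p_pos q_pos coprime] by blast
  hence f': "homogeneous3 (p + q - 1) f" "f \<noteq> 0" "vanishes_on_param p q f"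
    by (simp_all add: gate_form_def)
  have "is_cheb_form p q f"
    unfolding is_cheb_form_def using f' degree_minimal by blast
  hence "is_cheb_form p q (cheb_form p q)"
    unfolding cheb_form_def by (rule someI)
  then obtain d where d: "cheb_form p q \<noteq> 0" "homogeneous3 d (cheb_form p q)"
    "vanishes_on_param p q (cheb_form p q)" "d \<le> p + q - 1"
    unfolding is_cheb_form_def using f' by blast
  hence "d = p + q - 1"
    using degree_minimal[OF d(2,1,3)] by simp
  then obtain k where "k \<noteq> 0" "cheb_form p q = const3 k * f"
    using form_unique[OF f'] d by blast
  thus ?thesis
    using gate_form_const3_mult[OF f] by simp
qed

text \<open>The cofactor would vanish on the curve in degree p + q - 2, below the minimum.\<close>

lemma linear_not_dvd:
  assumes "homogeneous3 (p + q - 1) f" "f \<noteq> 0" "vanishes_on_param p q f"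
    and "homogeneous3 1 l" "\<not> vanishes_on_param p q l"
  shows "\<not> l dvd f"
proof
  assume "l dvd f"
  then obtain h where h: "f = l * h" ..
  hence nz: "l \<noteq> 0" "h \<noteq> 0" using assms(2) by auto
  have eq: "1 + (p + q - 2) = p + q - 1"
    using p_pos q_pos by simp
  have "homogeneous3 (1 + (p + q - 2)) (l * h)"
    using assms(1) unfolding eq h .
  hence "homogeneous3 (p + q - 2) h"
    by (rule homogeneous3_cancel[OF assms(4) _ nz(1)])
  moreover have "vanishes_on_param p q h"
    by (rule vanishes_on_param_cancel[OF assms(3)[unfolded h] assms(5)])
  ultimately have "p + q - 1 \<le> p + q - 2"
    using nz(2) by (intro degree_minimal)
  thus False using p_pos q_pos by simp
qed

end

lemma const3_uminus: "const3 (- k) = - const3 k"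
  using is_hom_diff[OF is_hom_const3, of 0 k] by (simp add: is_hom_zero[OF is_hom_const3])

text \<open>b \<plusminus> a are primes, neither of which divides the other or \<open>f\<close>, so
  the displayed exponents are the full multiplicities.\<close>

lemma proper_transform_eq:
  assumes pullback: "heron_pullback g = const3 k * (var_b + var_a) ^ n * (var_b - var_a) ^ m * f"
    and k: "k \<noteq> 0" and f: "eval3 f 1 0 0 \<noteq> 0" "\<not> var_b - var_a dvd f" "\<not> var_b + var_a dvd f"
  shows "proper_transform g = const3 k * f"
proof -
  have prime: "prime_elem (var_b - var_a)" "prime_elem (var_b + var_a)"
    using prime_elem_linear_form[of 1] prime_elem_linear_form[of "- 1"] by (simp_all add: const3_uminus)
  have not_dvd: "\<not> var_b - var_a dvd h" if "eval3 h 1 1 0 \<noteq> 0" for h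
    using that by (auto simp: dvd_def subst3_simps)
  have not_dvd': "\<not> var_b + var_a dvd h" if "eval3 h 1 (- 1) 0 \<noteq> 0" for h
    using that by (auto simp: dvd_def subst3_simps)
  have mult: "multiplicity l (l ^ i * h) = i" if "prime_elem l" "\<not> l dvd h" for l h :: poly3 and i
  proof (rule multiplicity_eqI)
    have "l \<noteq> 0" using that(1) by auto
    thus "\<not> l ^ Suc i dvd l ^ i * h"
      using that(2) by (simp add: mult.commute[of l])
  qed simp
  \<comment> \<open>The factor c never occurs: at (1, 0, 0), where c = 0, neither \<open>f\<close>
    nor b \<plusminus> a vanishes.\<close>
  have "multiplicity var_c (heron_pullback g) = 0"
  proof (rule not_dvd_imp_multiplicity_0)
    have "eval3 (heron_pullback g) 1 0 0 \<noteq> 0"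
      unfolding pullback using k f(1) by (simp add: subst3_simps)
    thus "\<not> var_c dvd heron_pullback g"
      by (auto simp: dvd_def subst3_simps)
  qed
  moreover have "multiplicity (var_b - var_a) (heron_pullback g) = m"
  proof -
    have "\<not> var_b - var_a dvd const3 k * (var_b + var_a) ^ n * f"
      using f(2) k not_dvd[of "const3 k * (var_b + var_a) ^ n"]
      by (simp add: prime_elem_dvd_mult_iff[OF prime(1)] subst3_simps)
    from mult[OF prime(1) this, of m] show ?thesis
      unfolding pullback by (simp add: mult_ac)
  qed
  moreover have "multiplicity (var_b + var_a) (heron_pullback g) = n"
  proof -
    have "\<not> var_b + var_a dvd const3 k * (var_b - var_a) ^ m * f"
      using f(3) k not_dvd'[of "const3 k * (var_b - var_a) ^ m"]
      by (simp add: prime_elem_dvd_mult_iff[OF prime(2)] subst3_simps)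
    from mult[OF prime(2) this, of n] show ?thesis
      unfolding pullback by (simp add: mult_ac)
  qed
  ultimately have "proper_transform g =
      (const3 k * (var_b + var_a) ^ n * (var_b - var_a) ^ m * f) div
      ((var_b - var_a) ^ m * (var_b + var_a) ^ n)"
    by (simp add: proper_transform_def Let_def pullback)
  also have "\<dots> = ((const3 k * f) * ((var_b - var_a) ^ m * (var_b + var_a) ^ n)) div
      ((var_b - var_a) ^ m * (var_b + var_a) ^ n)"
    by (simp add: mult_ac)
  also have "\<dots> = const3 k * f"
    using prime by (intro nonzero_mult_div_cancel_right) auto
  finally show ?thesis .
qed

lemma plane_curve_const3_mult:
  assumes "k \<noteq> 0"
  shows "plane_curve (const3 k * f) = plane_curve f"
proof -
  have hom: "const3 x * const3 y = const3 (x * y)" for x y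
    by (simp add: is_hom_mult[OF is_hom_const3])
  have scale: "g \<in> plane_curve f" if g: "g \<in> plane_curve (const3 k * f)" and k: "k \<noteq> 0" for g k f
  proof -
    obtain l where "l \<noteq> 0" "g = const3 (l * k) * f"
      using g by (auto simp: plane_curve_def hom simp flip: mult.assoc)
    thus ?thesis using k unfolding plane_curve_def by (intro CollectI exI[of _ "l * k"]) simp
  qed
  have inverse: "const3 (inverse k) * (const3 k * f) = f"
    using assms by (simp add: hom flip: mult.assoc)
  show ?thesis
    using scale[of _ k f] scale[of _ "inverse k" "const3 k * f", unfolded inverse] assms by auto
qed

section \<open>Exact gate multiplicities, singular points and the final statement\<close>

context cheb_pair
begin

lemma alg_mult_gate:
  assumes "gate_form p q f"
  shows "alg_mult f E_plus = (p - 1) div 2" "alg_mult f E_minus = p div 2"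
    "alg_mult f F_plus = (q - 1) div 2" "alg_mult f F_minus = q div 2"
    "alg_mult f G_plus = (p + q) div 2" "alg_mult f G_minus = (p + q - 1) div 2"
proof -
  have f: "homogeneous3 (p + q - 1) f" "f \<noteq> 0" "vanishes_on_param p q f"
    using assms by (simp_all add: gate_form_def)
  have eq: "alg_mult f (hpoint x y z) = m"
    if "vanishes_to_order m f x y z" "(x, y) \<noteq> (0, 0)" "card {t. cheb_param p q t = hpoint x y z} = m"
    for x y z m
  proof (rule antisym)
    show "alg_mult f (hpoint x y z) \<le> m"
      using alg_mult_le[OF f that(2), of z] that(3) by simp
    show "m \<le> alg_mult f (hpoint x y z)"
      using that(2) by (intro vanishes_to_order_imp_alg_mult_ge[OF f(1,2) _ that(1)]) auto
  qed
  have V: "vanishes_to_order ((p - 1) div 2) f 0 1 1" "vanishes_to_order (p div 2) f 0 1 (- 1)"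
    "vanishes_to_order ((q - 1) div 2) f 1 0 1" "vanishes_to_order (q div 2) f 1 0 (- 1)"
    "vanishes_to_order ((p + q) div 2) f 1 1 0" "vanishes_to_order ((p + q - 1) div 2) f 1 (- 1) 0"
    using assms unfolding gate_form_def by blast+
  note defs = E_plus_def E_minus_def F_plus_def F_minus_def G_plus_def G_minus_def
  note card = card_gate_params[unfolded defs]
  show "alg_mult f E_plus = (p - 1) div 2" "alg_mult f E_minus = p div 2"
    "alg_mult f F_plus = (q - 1) div 2" "alg_mult f F_minus = q div 2"
    "alg_mult f G_plus = (p + q) div 2" "alg_mult f G_minus = (p + q - 1) div 2"
    unfolding defs
    by (rule eq[OF V(1) _ card(1)] eq[OF V(2) _ card(2)] eq[OF V(3) _ card(3)]
        eq[OF V(4) _ card(4)] eq[OF V(5) _ card(5)] eq[OF V(6) _ card(6)], simp)+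
qed

lemma singular_point_cases:
  assumes "gate_form p q f" "singular_point f \<xi>"
  shows "\<xi> \<in> gate_points \<union> {G_zero}"
proof -
  have f: "homogeneous3 (p + q - 1) f" "f \<noteq> 0" "vanishes_on_param p q f"
    using assms by (simp_all add: gate_form_def)
  obtain x y z where \<xi>: "\<xi> = hpoint x y z" "(x, y, z) \<noteq> (0, 0, 0)"
    by (rule cp2_cases)
  show ?thesis
  proof (cases "(x, y) = (0, 0)")
    case True
    hence "\<xi> = G_zero"
      using \<xi> by (auto simp: G_zero_def hpoint_eq_iff_cross)
    thus ?thesis by simp
  next
    case False
    hence "card {t. cheb_param p q t = \<xi>} \<ge> 2"
      using assms(2) alg_mult_le[OF f False, of z] by (simp add: singular_point_def \<xi>(1))
    thus ?thesis
      using param_card_le_1[of x y z] False \<xi>(1) by fastforce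
  qed
qed

end

theorem theorem5:
  fixes p q :: nat
  assumes "p > 0" and "q > p" and "coprime p q"
  defines "f \<equiv> cheb_form p q"
  shows
    "cheb_curve p q = plane_curve (proper_transform (cheb_form p (q - p))) \<and>
     (\<forall>\<xi>. singular_point f \<xi> \<longrightarrow> \<xi> \<in> gate_points \<union> {G_zero}) \<and>
     alg_mult f G_zero = min p q \<and>
     (odd p \<and> odd q \<longrightarrow>
        alg_mult f E_plus = (p - 1) div 2 \<and>
        alg_mult f E_minus = (p - 1) div 2 \<and>
        alg_mult f F_plus = (q - 1) div 2 \<and>
        alg_mult f F_minus = (q - 1) div 2 \<and>
        alg_mult f G_plus = (p + q) div 2 \<and>
        alg_mult f G_minus = (p + q) div 2 - 1) \<and>
     (odd p \<and> even q \<longrightarrow>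
        alg_mult f E_plus = (p - 1) div 2 \<and>
        alg_mult f E_minus = (p - 1) div 2 \<and>
        alg_mult f F_plus = q div 2 - 1 \<and>
        alg_mult f F_minus = q div 2 \<and>
        alg_mult f G_plus = (p + q - 1) div 2 \<and>
        alg_mult f G_minus = (p + q - 1) div 2) \<and>
     (even p \<and> odd q \<longrightarrow>
        alg_mult f E_plus = p div 2 - 1 \<and>
        alg_mult f E_minus = p div 2 \<and>
        alg_mult f F_plus = (q - 1) div 2 \<and>
        alg_mult f F_minus = (q - 1) div 2 \<and>
        alg_mult f G_plus = (p + q - 1) div 2 \<and>
        alg_mult f G_minus = (p + q - 1) div 2) \<and>
     (\<forall>\<xi> \<in> gate_points.
        finite {t. cheb_param p q t = \<xi>} \<and> alg_mult f \<xi> = card {t. cheb_param p q t = \<xi>}) \<and>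
     (\<exists>k. k \<noteq> 0 \<and>
        heron_pullback (cheb_form p (q - p)) =
          const3 k *
          (var_b + var_a) ^ (if odd (q - p) then (q - p - 1) div 2 else (q - p) div 2) *
          (var_b - var_a) ^ (if odd (q - p) then (q - p - 1) div 2 else (q - p) div 2 - 1) *
          f)"
proof -
  define r where "r = q - p"
  have r: "r > 0" "q = p + r"
    using assms(2) by (simp_all add: r_def)
  have "coprime p r"
    using assms(2,3) gcd_diff1_nat[of p q] by (simp add: r_def coprime_iff_gcd_eq_1 gcd.commute[of p])
  interpret cheb_pair p q
    using assms by unfold_locales auto
  interpret base: cheb_pair p r
    using assms r \<open>coprime p r\<close> by unfold_locales auto
  have gate: "gate_form p q f"
    unfolding f_def by (rule gate_form_cheb_form)
  hence f: "homogeneous3 (p + q - 1) f" "f \<noteq> 0" "vanishes_on_param p q f"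
    by (simp_all add: gate_form_def)
  obtain f1 where "heron_step p r (cheb_form p r) f1"
    using heron_step_exists[OF assms(1) r(1) base.gate_form_cheb_form] .
  then interpret step: heron_step p r "cheb_form p r" f1 .
  have gate1: "gate_form p q f1"
    using step.gate_form r(2) by simp
  \<comment> \<open>The quotient \<open>f1\<close> of the pullback and the chosen \<open>f\<close>
    satisfy the same characterisation, so uniqueness turns the factorisation defining
    \<open>f1\<close> into one with \<open>f\<close>.\<close>
  obtain k where k: "k \<noteq> 0" "f1 = const3 k * f"
    using gate_form_unique[OF gate gate1] .
  \<comment> \<open>The other direction is needed to carry the order of \<open>f1\<close> at G_0
    over to \<open>f\<close>.\<close>
  obtain k' where k': "f = const3 k' * f1"
    using gate_form_unique[OF gate1 gate] .
  have pullback: "heron_pullback (cheb_form p r) =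
      const3 k * (var_b + var_a) ^ (r div 2) * (var_b - var_a) ^ ((r - 1) div 2) * f"
    unfolding step.pullback k(2) by (simp only: mult_ac)
  have "\<not> var_b - var_a dvd f" "\<not> var_b + var_a dvd f"
    using assms(1,2) homogeneous3_diff[OF homogeneous3_var(2,1)] homogeneous3_add[OF homogeneous3_var(2,1)]
    by (intro linear_not_dvd[OF f] not_vanishes_on_param_linear; simp)+
  hence "proper_transform (cheb_form p r) = const3 k * f"
    by (intro proper_transform_eq[OF pullback k(1)] eval3_nonzero[OF f])
  hence curve: "cheb_curve p q = plane_curve (proper_transform (cheb_form p (q - p)))"
    by (simp add: cheb_curve_def f_def plane_curve_const3_mult[OF k(1)] flip: r_def)
  have "vanishes_to_order p f 0 0 1"
    unfolding k' by (rule vanishes_to_order_const3_mult[OF step.vanishes_G_zero])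
  hence "p \<le> alg_mult f G_zero"
    unfolding G_zero_def by (intro vanishes_to_order_imp_alg_mult_ge[OF f(1,2)]) simp_all
  moreover have "alg_mult f G_zero + (q - 1) \<le> p + q - 1"
    unfolding G_zero_def by (rule alg_mult_G_zero_le[OF f])
  ultimately have G_zero: "alg_mult f G_zero = min p q"
    using assms(1,2) by linarith
  note mult = alg_mult_gate[OF gate]
  have gates: "\<forall>\<xi> \<in> gate_points.
      finite {t. cheb_param p q t = \<xi>} \<and> alg_mult f \<xi> = card {t. cheb_param p q t = \<xi>}"
    using finite_gate_params by (auto simp: gate_points_def mult card_gate_params)
  \<comment> \<open>r div 2 and (r - 1) div 2 express the parity-dependent exponents uniformly; r >
    0 matters for the truncated subtraction.\<close>
  have "(if odd r then (r - 1) div 2 else r div 2) = r div 2"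
    "(if odd r then (r - 1) div 2 else r div 2 - 1) = (r - 1) div 2"
    using r(1) by presburger+
  hence factor: "\<exists>k. k \<noteq> 0 \<and> heron_pullback (cheb_form p (q - p)) =
      const3 k * (var_b + var_a) ^ (if odd (q - p) then (q - p - 1) div 2 else (q - p) div 2) *
      (var_b - var_a) ^ (if odd (q - p) then (q - p - 1) div 2 else (q - p) div 2 - 1) * f"
    unfolding r_def[symmetric] using k(1) pullback by auto
  have half: "odd n \<Longrightarrow> n div 2 = (n - 1) div 2" "even n \<Longrightarrow> (n - 1) div 2 = n div 2 - 1" for n :: nat
    by presburger+
  show ?thesis
    using curve singular_point_cases[OF gate] G_zero gates factor half[of p] half[of q] half[of "p + q"]
    unfolding mult by (intro conjI) auto
qed

end
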